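(* Let $f\in\mathcal{S}^{\sharp}$ have degree $d\ge1$ and suppose that its order function satisfies $\mu(1/2)<d/4$. Then $f$ satisfies the Lindelöf hypothesis if and only if $$\sigma_{2k}(\alpha)=b\left(1-\frac{\alpha-1}{dk}\right)$$ for all $k\in\mathbb{N}$ and all real $\alpha>1$ with $k\ge\frac{\alpha-1}{d}$.
   Context: Write $s=\sigma+it$. The extended Selberg class $\mathcal{S}^{\sharp}$ consists of the functions $f$, not identically zero, such that: (i) $f(s)=\sum_{n\ge1}c_n n^{-s}$ is an absolutely convergent Dirichlet series for $\sigma>1$; (ii) $(s-1)^m f(s)$ extends to an entire function of finite order for some integer $m\ge0$; (iii) there are $Q>0$, an integer $r\ge 0$, $\lambda_j>0$, $\mu_j\in\mathbb{C}$ with $\operatorname{Re}\mu_j\ge0$ ($1\le j\le r$) and $|\omega|=1$ such that $\Phi(s)=Q^s\prod_{j=1}^r\Gamma(\lambda_j s+\mu_j)f(s)$ satisfies $\Phi(s)=\omega\,\overline{\Phi(1-\bar s)}$. The degree is $d=2\sum_{j=1}^r\lambda_j$. Order function: $\mu(\sigma)=\inf\{\mu\ge 0: f(\sigma+it)\ll t^{\mu}\ (t\ge1)\}$, $\sigma\in\mathbb{R}$. It is convex and non-increasing, and satisfies $\mu(\sigma)=\mu(1-\sigma)+d(\tfrac12-\sigma)$ and $\mu(\sigma)=0$ for $\sigma\ge1$. Let $b\le1$ be the number with $\mu(\sigma)>0$ for $\sigma<b$ and $\mu(\sigma)=0$ for $\sigma\ge b$. The Lindelöf hypothesis for $f$ is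 the statement $b=1/2$. $L^p$ abscissae: for $p>0$ and $\alpha>1$, $$\sigma_p(\alpha)=\inf\Big\{\sigma\le1: \Big(\int_1^\infty |f(\sigma+it)|^p\,\frac{dt}{t^\alpha}\Big)^{1/p}<\infty\Big\}.$$ *)

theory Defs
  imports "HOL-Complex_Analysis.Complex_Analysis"
begin

text \<open>
  A member of the extended Selberg class is represented by a total function on the complex plane
  whose value at the possible pole \<open>1\<close> is arbitrary; no definition below depends on that value.
\<close>

definition has_dirichlet_series :: "(complex \<Rightarrow> complex) \<Rightarrow> bool" where
  "has_dirichlet_series f \<longleftrightarrow>
     (\<exists>c :: nat \<Rightarrow> complex. \<forall>s. Re s > 1 \<longrightarrow>
        (\<lambda>n. norm (c n / of_nat n powr s)) summable_on {1..} \<and>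
        ((\<lambda>n. c n / of_nat n powr s) has_sum f s) {1..})"

definition entire_of_finite_order :: "(complex \<Rightarrow> complex) \<Rightarrow> bool" where
  "entire_of_finite_order g \<longleftrightarrow>
     g holomorphic_on UNIV \<and>
     (\<exists>C \<rho> :: real. \<forall>s. norm (g s) \<le> C * exp (norm s powr \<rho>))"

definition has_continuation :: "(complex \<Rightarrow> complex) \<Rightarrow> bool" where
  "has_continuation f \<longleftrightarrow>
     (\<exists>(m :: nat) g. entire_of_finite_order g \<and> (\<forall>s. s \<noteq> 1 \<longrightarrow> g s = (s - 1) ^ m * f s))"

definition completed ::
    "(complex \<Rightarrow> complex) \<Rightarrow> real \<Rightarrow> nat \<Rightarrow> (nat \<Rightarrow> real) \<Rightarrow> (nat \<Rightarrow> complex) \<Rightarrow> complex \<Rightarrow> complex" where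
  "completed f Q r lam mu s =
     of_real Q powr s * (\<Prod>j=1..r. Gamma (of_real (lam j) * s + mu j)) * f s"

text \<open>
  The functional equation is an identity of meromorphic functions. Since \<open>Gamma\<close> takes the value
  \<open>0\<close> at its poles, it is required pointwise only where \<open>f\<close> and all Gamma factors occurring on
  either side are regular; the excluded points form a discrete closed set.
\<close>

definition satisfies_functional_equation ::
    "(complex \<Rightarrow> complex) \<Rightarrow> real \<Rightarrow> nat \<Rightarrow> (nat \<Rightarrow> real) \<Rightarrow> (nat \<Rightarrow> complex) \<Rightarrow> complex \<Rightarrow> bool" where
  "satisfies_functional_equation f Q r lam mu \<omega> \<longleftrightarrow>
     Q > 0 \<and> (\<forall>j\<in>{1..r}. lam j > 0 \<and> Re (mu j) \<ge> 0) \<and> norm \<omega> = 1 \<and>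
     (\<forall>s. s \<notin> {0, 1} \<and>
          (\<forall>j\<in>{1..r}. of_real (lam j) * s + mu j \<notin> \<int>\<^sub>\<le>\<^sub>0 \<and>
                      of_real (lam j) * (1 - cnj s) + mu j \<notin> \<int>\<^sub>\<le>\<^sub>0) \<longrightarrow>
          completed f Q r lam mu s = \<omega> * cnj (completed f Q r lam mu (1 - cnj s)))"

definition extended_selberg :: "(complex \<Rightarrow> complex) \<Rightarrow> bool" where
  "extended_selberg f \<longleftrightarrow>
     (\<exists>s. s \<noteq> 1 \<and> f s \<noteq> 0) \<and> has_dirichlet_series f \<and> has_continuation f \<and>
     (\<exists>Q r lam mu \<omega>. satisfies_functional_equation f Q r lam mu \<omega>)"

text \<open>
  The data of a functional equation are not unique, so the degree is given as a relation between
  \<open>f\<close> and \<open>d\<close> rather than by choosing some data.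
\<close>

definition has_degree :: "(complex \<Rightarrow> complex) \<Rightarrow> real \<Rightarrow> bool" where
  "has_degree f d \<longleftrightarrow>
     (\<exists>Q r lam mu \<omega>. satisfies_functional_equation f Q r lam mu \<omega> \<and> d = 2 * (\<Sum>j=1..r. lam j))"

definition order_function :: "(complex \<Rightarrow> complex) \<Rightarrow> real \<Rightarrow> real" where
  "order_function f \<sigma> =
     Inf {e. e \<ge> 0 \<and> (\<exists>C. \<forall>t\<ge>1. norm (f (Complex \<sigma> t)) \<le> C * t powr e)}"

definition order_abscissa :: "(complex \<Rightarrow> complex) \<Rightarrow> real" where
  "order_abscissa f =
     (THE b. b \<le> 1 \<and> (\<forall>\<sigma><b. order_function f \<sigma> > 0) \<and> (\<forall>\<sigma>\<ge>b. order_function f \<sigma> = 0))"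

definition lindelof_hypothesis :: "(complex \<Rightarrow> complex) \<Rightarrow> bool" where
  "lindelof_hypothesis f \<longleftrightarrow> order_abscissa f = 1 / 2"

text \<open>
  The outer exponent \<open>1 / p\<close> of the \<open>L\<^sup>p\<close> norm does not affect finiteness and is omitted.
\<close>

definition Lp_abscissa :: "(complex \<Rightarrow> complex) \<Rightarrow> real \<Rightarrow> real \<Rightarrow> real" where
  "Lp_abscissa f p \<alpha> =
     Inf {\<sigma>. \<sigma> \<le> 1 \<and>
            (\<integral>\<^sup>+t\<in>{1..}. ennreal (norm (f (Complex \<sigma> t)) powr p / t powr \<alpha>) \<partial>lborel) < \<infinity>}"

end

theory Submission
  imports Defs "HOL-Real_Asymp.Real_Asymp"
begin

text \<open>
  Reflecting \<open>s\<close> to \<open>1 - cnj s\<close> multiplies \<open>norm (f s)\<close> by \<open>t powr (d * (1 / 2 - \<sigma>))\<close> up to a constant, so a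
  finite \<open>2k\<close>-th moment at \<open>\<sigma>\<close> amounts to a weighted moment at \<open>1 - \<sigma>\<close>. Whenever the order at
  \<open>1 - \<sigma>\<close> is below 1, shifting the contour to where the leading Dirichlet coefficient dominates
  shows that the mean of \<open>norm f\<close> over \<open>[T, 2T]\<close> is bounded below, hence the moment diverges once
  \<open>2kd(1/2 - \<sigma>) \<ge> \<alpha> - 1\<close>. It converges once \<open>2k\<mu>(\<sigma>) < \<alpha> - 1\<close>. If \<open>b = 1/2\<close>, these two ranges meet in
  the claimed abscissa.

  Conversely, the convergence criterion with \<open>k = 1\<close> turns the formula into the lower bound
  \<open>\<mu>(\<sigma>) \<ge> (d/2)(1 - \<sigma>/b)\<close> for \<open>0 \<le> \<sigma> < b\<close>. If \<open>1/2 < b < 1\<close>, this exceeds the value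
  \<open>\<mu>(1 - b) = d(b - 1/2)\<close> given by the functional equation; if \<open>b = 1\<close>, it contradicts
  \<open>\<mu>(1/2) < d/4\<close>.
\<close>

subsection \<open>The Gamma function on vertical lines\<close>

text \<open>The size of the Gamma factors never enters. The points \<open>s\<close> and
  \<open>1 - cnj s\<close> have the same height, so norms in the functional equation leave only
  quotients of \<open>Gamma\<close> at equal height, which come from integrating
  \<open>Re (Digamma z) = ln y + O(1)\<close> along horizontal segments. Order below 1 is required
  for the mean value bound because it compares sides of a rectangle of height T: the dominant side
  contributes a multiple of T, the horizontal sides only O(T^e). The two implications use divergence
  differently. If b = 1/2, the order vanishes on the whole reflected side, and divergence extends up
  to the claimed abscissa. In the converse it is applied only for \<sigma> < 0, where 1 - \<sigma>
  lies in the half plane of absolute convergence; its sole purpose there is to make the abscissa a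
  genuine infimum. At 1 - b the formula forces order at least d(b - 1/2)/b, whereas reflection
  allows d(b - 1/2). This gap closes exactly at b = 1, which is why that case needs separate
  information: there the forced bound (d/2)(1 - \<sigma>) takes the value d/4 at 1/2.\<close>

lemma abs_half_ln_increment_le:
  fixes u y b :: real
  assumes y: "y \<ge> 1" and b: "\<And>v. \<lbrakk>u \<le> v; v \<le> u + 1\<rbrakk> \<Longrightarrow> 1 / (v\<^sup>2 + 1) \<le> b"
  shows "\<bar>u / (u\<^sup>2 + y\<^sup>2) - (ln ((u + 1)\<^sup>2 + y\<^sup>2) / 2 - ln (u\<^sup>2 + y\<^sup>2) / 2)\<bar> \<le> b"
proof -
  have pos: "v\<^sup>2 + y\<^sup>2 > 0" for v :: real
    using y by (intro add_nonneg_pos) auto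
  \<comment> \<open>The quotient is the derivative of half the logarithm, so the unit increment
    equals the quotient at some \<xi>. A second mean value step from u to \<xi> leaves the second
    derivative, at most 1/(v^2 + y^2). Since y \<ge> 1, this gives a bound independent of y, as
    needed for summing over n.\<close>
  have "\<exists>\<xi>>u. \<xi> < u + 1 \<and> ln ((u + 1)\<^sup>2 + y\<^sup>2) / 2 - ln (u\<^sup>2 + y\<^sup>2) / 2 = (u + 1 - u) * (\<xi> / (\<xi>\<^sup>2 + y\<^sup>2))"
  proof (rule MVT2)
    fix x :: real
    have "((\<lambda>u. ln (u\<^sup>2 + y\<^sup>2)) has_real_derivative 2 * x / (x\<^sup>2 + y\<^sup>2)) (at x)"
      using pos[of x] by (auto intro!: derivative_eq_intros)
    hence "((\<lambda>u. ln (u\<^sup>2 + y\<^sup>2) / 2) has_real_derivative 2 * x / (x\<^sup>2 + y\<^sup>2) / 2) (at x)"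
      by (rule DERIV_cdivide)
    moreover have "2 * x / D / 2 = x / D" for D by simp
    ultimately show "((\<lambda>u. ln (u\<^sup>2 + y\<^sup>2) / 2) has_real_derivative x / (x\<^sup>2 + y\<^sup>2)) (at x)" by metis
  qed auto
  then obtain \<xi> where \<xi>: "u < \<xi>" "\<xi> < u + 1"
    "ln ((u + 1)\<^sup>2 + y\<^sup>2) / 2 - ln (u\<^sup>2 + y\<^sup>2) / 2 = \<xi> / (\<xi>\<^sup>2 + y\<^sup>2)" by auto
  have "\<exists>v>u. v < \<xi> \<and> \<xi> / (\<xi>\<^sup>2 + y\<^sup>2) - u / (u\<^sup>2 + y\<^sup>2) = (\<xi> - u) * ((y\<^sup>2 - v\<^sup>2) / (v\<^sup>2 + y\<^sup>2)\<^sup>2)"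
  proof (rule MVT2)
    fix x :: real
    have "((\<lambda>u. u / (u\<^sup>2 + y\<^sup>2)) has_real_derivative
      (1 * (x\<^sup>2 + y\<^sup>2) - x * (2 * x)) / ((x\<^sup>2 + y\<^sup>2) * (x\<^sup>2 + y\<^sup>2))) (at x)"
      using pos[of x] by (auto intro!: derivative_eq_intros)
    moreover have "1 * (x\<^sup>2 + y\<^sup>2) - x * (2 * x) = y\<^sup>2 - x\<^sup>2" by (simp add: power2_eq_square)
    ultimately show "((\<lambda>u. u / (u\<^sup>2 + y\<^sup>2)) has_real_derivative (y\<^sup>2 - x\<^sup>2) / (x\<^sup>2 + y\<^sup>2)\<^sup>2) (at x)"
      by (simp only: power2_eq_square[of "x\<^sup>2 + y\<^sup>2"])
  qed (use \<xi> in auto)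
  then obtain v where v: "u < v" "v < \<xi>"
    "\<xi> / (\<xi>\<^sup>2 + y\<^sup>2) - u / (u\<^sup>2 + y\<^sup>2) = (\<xi> - u) * ((y\<^sup>2 - v\<^sup>2) / (v\<^sup>2 + y\<^sup>2)\<^sup>2)" by auto
  have "\<bar>(y\<^sup>2 - v\<^sup>2) / (v\<^sup>2 + y\<^sup>2)\<^sup>2\<bar> \<le> (v\<^sup>2 + y\<^sup>2) / (v\<^sup>2 + y\<^sup>2)\<^sup>2"
    unfolding abs_divide by (intro divide_mono) (use pos[of v] in \<open>auto simp: abs_if\<close>)
  also have "\<dots> = 1 / (v\<^sup>2 + y\<^sup>2)" using pos[of v] by (simp add: power2_eq_square)
  also have "\<dots> \<le> 1 / (v\<^sup>2 + 1)"
    using y by (intro divide_left_mono) (auto intro!: mult_pos_pos add_nonneg_pos one_le_power)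
  also have "\<dots> \<le> b" using v \<xi> by (intro b) auto
  finally have *: "\<bar>(y\<^sup>2 - v\<^sup>2) / (v\<^sup>2 + y\<^sup>2)\<^sup>2\<bar> \<le> b" .
  have "\<bar>(\<xi> - u) * ((y\<^sup>2 - v\<^sup>2) / (v\<^sup>2 + y\<^sup>2)\<^sup>2)\<bar> \<le> 1 * b"
    unfolding abs_mult by (intro mult_mono *) (use v \<xi> in auto)
  thus ?thesis unfolding \<xi>(3) v(3)[symmetric] by (simp add: abs_minus_commute)
qed

lemma Re_inverse_Complex_plus_of_nat:
  "Re (inverse (Complex x y + of_nat n)) = (x + real n) / ((x + real n)\<^sup>2 + y\<^sup>2)"
  by simp

text \<open>\<open>Digamma z\<close> is the limit of ln m minus the sum of 1/(z + n) over n < m.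
  Comparing the real parts of the summands with telescoping increments of \<open>G\<close> costs a
  convergent series, uniformly in y. In the limit ln m cancels against G(x + m), which leaves G x,
  and this is ln y up to a constant.\<close>

lemma Re_Digamma_bound:
  fixes M :: real
  assumes "M \<ge> 0"
  obtains K where "\<And>x y. \<lbrakk>\<bar>x\<bar> \<le> M; y \<ge> 1\<rbrakk> \<Longrightarrow> \<bar>Re (Digamma (Complex x y)) - ln y\<bar> \<le> K"
proof -
  \<comment> \<open>Chosen so that |v - (n + 1)| \<le> M + 1 implies (n + 1)^2 \<le> K0 (v^2 + 1),
    via (n + 1)^2 \<le> 2 v^2 + 2 (v - (n + 1))^2.\<close>
  define K0 where "K0 = 2 * ((M + 1)\<^sup>2 + 1)"
  define S where "S = (\<Sum>n. inverse ((real n + 1)\<^sup>2))"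
  have summ: "summable (\<lambda>n. inverse ((real n + 1)\<^sup>2))"
    using inverse_squares_sums by (simp add: sums_iff inverse_eq_divide add.commute)
  have K0: "K0 \<ge> 0" unfolding K0_def by simp
  show ?thesis
  proof (rule that[of "K0 * S + ln (1 + M\<^sup>2)"])
    fix x y :: real assume x: "\<bar>x\<bar> \<le> M" and y: "y \<ge> 1"
    define G where "G u = ln (u\<^sup>2 + y\<^sup>2) / 2" for u
    define z where "z = Complex x y"
    have z: "z \<noteq> 0" using y by (auto simp: z_def complex_eq_iff)
    have summand: "\<bar>(x + real n) / ((x + real n)\<^sup>2 + y\<^sup>2) - (G (x + real (Suc n)) - G (x + real n))\<bar>
      \<le> K0 * inverse ((real n + 1)\<^sup>2)" for n
    proof -
      have "\<bar>(x + real n) / ((x + real n)\<^sup>2 + y\<^sup>2) - (ln ((x + real n + 1)\<^sup>2 + y\<^sup>2) / 2 - ln ((x + real n)\<^sup>2 + y\<^sup>2) / 2)\<bar>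
        \<le> K0 * inverse ((real n + 1)\<^sup>2)"
      proof (rule abs_half_ln_increment_le[OF y])
        fix v assume v: "x + real n \<le> v" "v \<le> x + real n + 1"
        have "\<bar>v - (real n + 1)\<bar> \<le> M + 1" using v x by linarith
        hence "(v - (real n + 1))\<^sup>2 \<le> (M + 1)\<^sup>2" using assms by (intro power2_le_iff_abs_le[THEN iffD2]) auto
        moreover have "(real n + 1)\<^sup>2 \<le> 2 * v\<^sup>2 + 2 * (v - (real n + 1))\<^sup>2"
          using zero_le_power2[of "2 * v - (real n + 1)"] by (simp add: power2_eq_square algebra_simps)
        moreover have "2 * (v\<^sup>2 + (M + 1)\<^sup>2) \<le> K0 * (v\<^sup>2 + 1)"
          unfolding K0_def by (simp add: algebra_simps)
        ultimately have "(real n + 1)\<^sup>2 \<le> K0 * (v\<^sup>2 + 1)" by argo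
        thus "1 / (v\<^sup>2 + 1) \<le> K0 * inverse ((real n + 1)\<^sup>2)"
          by (subst pos_divide_le_eq) (auto simp: inverse_eq_divide pos_le_divide_eq intro!: add_nonneg_pos)
      qed
      thus ?thesis by (simp add: G_def algebra_simps)
    qed
    have partial: "\<bar>Re (of_real (ln (real m)) - (\<Sum>n<m. inverse (z + of_nat n))) - (ln (real m) - G (x + real m) + G x)\<bar>
       \<le> K0 * S" for m
    proof -
      have "(\<Sum>n<m. G (x + real (Suc n)) - G (x + real n)) = G (x + real m) - G x"
        by (subst sum_lessThan_telescope) simp
      hence "\<bar>Re (of_real (ln (real m)) - (\<Sum>n<m. inverse (z + of_nat n))) - (ln (real m) - G (x + real m) + G x)\<bar>
        = \<bar>\<Sum>n<m. (x + real n) / ((x + real n)\<^sup>2 + y\<^sup>2) - (G (x + real (Suc n)) - G (x + real n))\<bar>"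
        unfolding z_def minus_complex.simps Re_sum Re_inverse_Complex_plus_of_nat
        by (simp add: sum_subtractf)
      also have "\<dots> \<le> (\<Sum>n<m. K0 * inverse ((real n + 1)\<^sup>2))"
        by (rule order.trans[OF sum_abs sum_mono]) (rule summand)
      also have "\<dots> \<le> K0 * S"
        unfolding sum_distrib_left[symmetric] S_def
        by (intro mult_left_mono sum_le_suminf summ K0) auto
      finally show ?thesis .
    qed
    have "(\<lambda>m. Re (of_real (ln (real m)) - (\<Sum>n<m. inverse (z + of_nat n)))) \<longlonglongrightarrow> Re (Digamma z)"
      by (intro tendsto_Re Digamma_LIMSEQ z)
    moreover have "(\<lambda>m. ln (real m) - G (x + real m) + G x) \<longlonglongrightarrow> G x"
      unfolding G_def by real_asymp
    ultimately have "(\<lambda>m. \<bar>Re (of_real (ln (real m)) - (\<Sum>n<m. inverse (z + of_nat n))) - (ln (real m) - G (x + real m) + G x)\<bar>)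
      \<longlonglongrightarrow> \<bar>Re (Digamma z) - G x\<bar>"
      by (intro tendsto_rabs tendsto_diff)
    hence 1: "\<bar>Re (Digamma z) - G x\<bar> \<le> K0 * S"
      by (rule tendsto_upperbound) (use partial in auto)
    have "x\<^sup>2 \<le> M\<^sup>2" using x abs_le_square_iff[of x M] by auto
    also have "M\<^sup>2 \<le> M\<^sup>2 * y\<^sup>2" using y mult_left_mono[of 1 "y\<^sup>2" "M\<^sup>2"] by simp
    finally have "ln (x\<^sup>2 + y\<^sup>2) \<le> ln ((1 + M\<^sup>2) * y\<^sup>2)"
      using y by (intro ln_mono add_nonneg_pos) (auto simp: algebra_simps)
    also have "\<dots> = ln (1 + M\<^sup>2) + 2 * ln y"
      using y by (subst ln_mult_pos) (auto simp: ln_realpow intro!: add_pos_nonneg)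
    finally have 2: "2 * G x \<le> ln (1 + M\<^sup>2) + 2 * ln y" by (simp add: G_def)
    have "ln (y\<^sup>2) \<le> ln (x\<^sup>2 + y\<^sup>2)"
      using y by (subst ln_le_cancel_iff) (auto intro!: add_nonneg_pos)
    hence 3: "2 * ln y \<le> 2 * G x" using y by (simp add: ln_realpow G_def)
    have 4: "ln (1 + M\<^sup>2) \<ge> 0" by simp
    show "\<bar>Re (Digamma (Complex x y)) - ln y\<bar> \<le> K0 * S + ln (1 + M\<^sup>2)"
      using 1 2 3 4 unfolding z_def by linarith
  qed
qed

text \<open>Along a horizontal line the logarithm of the norm of \<open>Gamma\<close> has derivative
  Re \<open>Digamma\<close>, which is ln y + O(1). After subtracting u ln y it is therefore
  Lipschitz in u with a constant independent of y. This takes the place of Stirling's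
  formula.\<close>

lemma norm_Gamma_ratio_bound:
  fixes x x' :: real
  obtains K where "K > 0"
    "\<And>y. y \<ge> 1 \<Longrightarrow> norm (Gamma (Complex x y)) \<le> K * y powr (x - x') * norm (Gamma (Complex x' y))"
proof -
  define M where "M = max \<bar>x\<bar> \<bar>x'\<bar>"
  obtain K where K: "\<And>x y. \<lbrakk>\<bar>x\<bar> \<le> M; y \<ge> 1\<rbrakk> \<Longrightarrow> \<bar>Re (Digamma (Complex x y)) - ln y\<bar> \<le> K"
    using Re_Digamma_bound[of M] unfolding M_def by (meson abs_ge_zero max.coboundedI1)
  show ?thesis
  proof (rule that[of "exp (K * \<bar>x - x'\<bar>)"])
    fix y :: real assume y: "y \<ge> 1"
    have nonpos: "Complex u y \<notin> \<real>\<^sub>\<le>\<^sub>0" for u using y by (auto simp: complex_nonpos_Reals_iff)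
    have nonpos': "Complex u y \<notin> \<int>\<^sub>\<le>\<^sub>0" for u using y by (auto elim!: nonpos_Ints_cases simp: complex_eq_iff)
    have G: "norm (Gamma (Complex u y)) = exp (Re (ln_Gamma (Complex u y)))" for u
      using nonpos' by (simp add: Gamma_complex_altdef)
    define h where "h u = Re (ln_Gamma (Complex u y)) - u * ln y" for u
    have deriv: "(h has_real_derivative (Re (Digamma (Complex u y)) - ln y)) (at u)" for u
    proof -
      have "((\<lambda>u. Complex u y) has_vector_derivative 1) (at u)"
        unfolding Complex_eq by (auto intro!: derivative_eq_intros)
      from field_vector_diff_chain_at[OF this has_field_derivative_ln_Gamma_complex[OF nonpos]]
      have "((\<lambda>u. ln_Gamma (Complex u y)) has_vector_derivative Digamma (Complex u y)) (at u)"
        by (simp add: o_def)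
      hence "((\<lambda>u. Re (ln_Gamma (Complex u y))) has_vector_derivative Re (Digamma (Complex u y))) (at u)"
        by (auto dest: bounded_linear.has_vector_derivative[OF bounded_linear_Re])
      hence "((\<lambda>u. Re (ln_Gamma (Complex u y))) has_real_derivative Re (Digamma (Complex u y))) (at u)"
        by (simp add: has_real_derivative_iff_has_vector_derivative)
      thus ?thesis unfolding h_def by (intro DERIV_diff) (auto intro!: derivative_eq_intros)
    qed
    have "norm (h x - h x') \<le> K * norm (x - x')"
    proof (rule field_differentiable_bound[of "{-M..M}" h "\<lambda>u. Re (Digamma (Complex u y)) - ln y"])
      fix u assume "u \<in> {-M..M}"
      thus "norm (Re (Digamma (Complex u y)) - ln y) \<le> K" using K[of u y] y by auto
    qed (use deriv in \<open>auto simp: M_def intro: DERIV_subset\<close>)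
    hence "Re (ln_Gamma (Complex x y)) \<le> K * \<bar>x - x'\<bar> + (x - x') * ln y + Re (ln_Gamma (Complex x' y))"
      unfolding h_def by (simp add: abs_le_iff algebra_simps)
    thus "norm (Gamma (Complex x y)) \<le> exp (K * \<bar>x - x'\<bar>) * y powr (x - x') * norm (Gamma (Complex x' y))"
      using y by (simp add: G powr_def exp_add[symmetric])
  qed auto
qed

subsection \<open>The Phragmen--Lindeloef principle in a half strip\<close>

lemma norm_one_plus_power_minus_one_le:
  fixes w :: "'a :: real_normed_field"
  shows "norm ((1 + w) ^ m - 1) \<le> (1 + norm w) ^ m - 1"
proof (induction m)
  case (Suc m)
  have "(1 + w) ^ Suc m - 1 = (1 + w) * ((1 + w) ^ m - 1) + w" by (simp add: algebra_simps)
  hence "norm ((1 + w) ^ Suc m - 1) \<le> norm (1 + w) * norm ((1 + w) ^ m - 1) + norm w"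
    by (metis norm_mult norm_triangle_ineq)
  also have "\<dots> \<le> (1 + norm w) * ((1 + norm w) ^ m - 1) + norm w"
    using norm_triangle_ineq[of 1 w] by (intro add_right_mono mult_mono Suc.IH) auto
  also have "\<dots> = (1 + norm w) ^ Suc m - 1" by (simp add: algebra_simps)
  finally show ?case .
qed simp

text \<open>After division by x the base is 1 + w with m |w| \<le> 1/3, so its m-th power differs
  from 1 by at most exp(1/3) - 1, which is below 1/2.\<close>

lemma Re_power_ge_half:
  fixes x y :: real
  assumes x: "x > 0" and y: "3 * real m * \<bar>y\<bar> \<le> x"
  shows "Re ((Complex x y) ^ m) \<ge> x ^ m / 2"
proof -
  define w where "w = \<i> * of_real (y / x)"
  have eq: "Complex x y = of_real x * (1 + w)" using x by (simp add: w_def complex_eq_iff)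
  have nw: "norm w = \<bar>y\<bar> / x" using x by (simp add: w_def norm_mult norm_divide)
  have mw: "real m * norm w \<le> 1 / 3" using x y by (simp add: nw field_simps)
  have "(1 + norm w) ^ m \<le> exp (norm w) ^ m" by (intro power_mono) auto
  also have "\<dots> = exp (real m * norm w)" by (simp add: exp_of_nat_mult)
  also have "\<dots> \<le> exp (1 / 3)" using mw by simp
  also have "\<dots> \<le> 1 + 1 / 3 + (1 / 3)\<^sup>2" by (rule exp_bound) auto
  also have "\<dots> \<le> 3 / 2" by (simp add: power2_eq_square)
  finally have "norm ((1 + w) ^ m - 1) \<le> 1 / 2"
    using norm_one_plus_power_minus_one_le[of w m] by linarith
  hence "Re ((1 + w) ^ m) \<ge> 1 / 2"
    using abs_Re_le_cmod[of "(1 + w) ^ m - 1"] by simp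
  hence "x ^ m * (1 / 2) \<le> x ^ m * Re ((1 + w) ^ m)" using x by (intro mult_left_mono) auto
  also have "\<dots> = Re ((Complex x y) ^ m)"
    unfolding eq power_mult_distrib of_real_power[symmetric] by simp
  finally show ?thesis by simp
qed

text \<open>A damping factor of norm at most 1 leaves the three edge bounds intact and makes the
  function small on a sufficiently high top edge. The maximum principle then applies to the
  truncated rectangle, and letting \<epsilon> tend to 0 removes the damping.\<close>

lemma phragmen_lindelof_half_strip:
  fixes f :: "complex \<Rightarrow> complex" and a b B C :: real
  assumes hol: "f holomorphic_on {s. Im s > 0}"
    and growth: "\<And>s. \<lbrakk>a \<le> Re s; Re s \<le> b; Im s \<ge> 1\<rbrakk> \<Longrightarrow> norm (f s) \<le> C * exp (norm s ^ n)"
    and left: "\<And>s. \<lbrakk>Re s = a; Im s \<ge> 1\<rbrakk> \<Longrightarrow> norm (f s) \<le> B"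
    and right: "\<And>s. \<lbrakk>Re s = b; Im s \<ge> 1\<rbrakk> \<Longrightarrow> norm (f s) \<le> B"
    and bottom: "\<And>s. \<lbrakk>a \<le> Re s; Re s \<le> b; Im s = 1\<rbrakk> \<Longrightarrow> norm (f s) \<le> B"
    and B: "B > 0"
    and s: "a \<le> Re s" "Re s \<le> b" "Im s \<ge> 1"
  shows "norm (f s) \<le> B"
proof -
  define A where "A = max \<bar>a\<bar> \<bar>b\<bar>"
  define m where "m = Suc n"
  define K where "K = 3 * real m * A"
  \<comment> \<open>The shift by \<open>K\<close> keeps the argument of the base so small that \<open>Re (P z)\<close> is positive in the whole
      half strip; as \<open>m > n\<close>, the factor \<open>exp (- \<epsilon> * P z)\<close> beats the growth of \<open>f\<close>.\<close>
  define P where "P z = (- \<i> * z + of_real K) ^ m" for z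
  have A: "A \<ge> 0" by (simp add: A_def)
  have ReA: "\<bar>Re z\<bar> \<le> A" if "a \<le> Re z" "Re z \<le> b" for z using that by (auto simp: A_def)
  have K: "K \<ge> 0" using A by (simp add: K_def)
  have P: "Re (P z) \<ge> Im z ^ m / 2" if z: "a \<le> Re z" "Re z \<le> b" "Im z \<ge> 1" for z
  proof -
    have "3 * real m * \<bar>- Re z\<bar> \<le> K" unfolding K_def abs_minus_cancel
      by (intro mult_left_mono ReA z) auto
    hence "Re (Complex (Im z + K) (- Re z) ^ m) \<ge> (Im z + K) ^ m / 2"
      using z K by (intro Re_power_ge_half) auto
    moreover have "Complex (Im z + K) (- Re z) = - \<i> * z + of_real K" by (simp add: complex_eq_iff)
    moreover have "Im z ^ m \<le> (Im z + K) ^ m" using z K by (intro power_mono) auto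
    ultimately show ?thesis unfolding P_def by auto
  qed
  have "norm (f s) * exp (- \<epsilon> * Re (P s)) \<le> B" if \<epsilon>: "\<epsilon> > 0" for \<epsilon>
  proof -
    define F where "F z = f z * exp (- of_real \<epsilon> * P z)" for z
    have norm_F: "norm (F z) = norm (f z) * exp (- \<epsilon> * Re (P z))" for z
      by (simp add: F_def norm_mult)
    have F_le: "norm (F z) \<le> norm (f z)" if z: "a \<le> Re z" "Re z \<le> b" "Im z \<ge> 1" for z
    proof -
      have "Re (P z) \<ge> 0" using P[OF z] z by (intro order.trans[OF _ P[OF z]]) auto
      hence "exp (- \<epsilon> * Re (P z)) \<le> 1" using \<epsilon> by simp
      thus ?thesis unfolding norm_F using mult_left_le norm_ge_zero by blast
    qed
    \<comment> \<open>At height t \<ge> 1 the norm of z is at most (1 + A) t and Re (P z) is at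
      least t^(n+1)/2, so this expression majorises the damped function on the top edge.\<close>
    have "((\<lambda>t. \<bar>C\<bar> * exp ((1 + A) ^ n * t ^ n - \<epsilon> * (t ^ Suc n / 2))) \<longlongrightarrow> 0) at_top"
    proof -
      have "filterlim (\<lambda>t. t ^ n * (\<epsilon> * t / 2 - (1 + A) ^ n)) at_top at_top"
      proof (rule filterlim_at_top_mono)
        show "filterlim (\<lambda>t. \<epsilon> * t / 2 - (1 + A) ^ n) at_top at_top" using \<epsilon> by real_asymp
        have "eventually (\<lambda>t. \<epsilon> * t / 2 - (1 + A) ^ n \<ge> 0) at_top" using \<epsilon> by real_asymp
        thus "eventually (\<lambda>t. \<epsilon> * t / 2 - (1 + A) ^ n \<le> t ^ n * (\<epsilon> * t / 2 - (1 + A) ^ n)) at_top"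
          using eventually_ge_at_top[of 1]
        proof eventually_elim
          case (elim t)
          have "1 * (\<epsilon> * t / 2 - (1 + A) ^ n) \<le> t ^ n * (\<epsilon> * t / 2 - (1 + A) ^ n)"
            using elim by (intro mult_right_mono) auto
          thus ?case by simp
        qed
      qed
      hence "filterlim (\<lambda>t. - (t ^ n * (\<epsilon> * t / 2 - (1 + A) ^ n))) at_bot at_top"
        by (simp add: filterlim_uminus_at_top)
      hence "((\<lambda>t. exp (- (t ^ n * (\<epsilon> * t / 2 - (1 + A) ^ n)))) \<longlongrightarrow> 0) at_top"
        by (rule filterlim_compose[OF exp_at_bot])
      from tendsto_mult_right_zero[OF this, of "\<bar>C\<bar>"] show ?thesis
        by (simp add: algebra_simps)
    qed
    hence "eventually (\<lambda>t. \<bar>C\<bar> * exp ((1 + A) ^ n * t ^ n - \<epsilon> * (t ^ Suc n / 2)) < B) at_top"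
      by (rule order_tendstoD) (rule B)
    moreover have "eventually (\<lambda>t. t > Im s) at_top" by (rule eventually_gt_at_top)
    ultimately have "eventually (\<lambda>t. \<bar>C\<bar> * exp ((1 + A) ^ n * t ^ n - \<epsilon> * (t ^ Suc n / 2)) < B \<and> t > Im s) at_top"
      by (rule eventually_conj)
    then obtain T where T: "\<bar>C\<bar> * exp ((1 + A) ^ n * T ^ n - \<epsilon> * (T ^ Suc n / 2)) < B" "T > Im s"
      by (auto simp: eventually_at_top_linorder)
    have top: "norm (F z) \<le> B" if z: "a \<le> Re z" "Re z \<le> b" "Im z = T" for z
    proof -
      have T1: "T \<ge> 1" using T s by simp
      have "norm z \<le> A + T" using cmod_le[of z] ReA[OF z(1,2)] z T1 by linarith
      also have "\<dots> \<le> (1 + A) * T" using T1 A by (simp add: algebra_simps mult_le_cancel_left1)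
      finally have "norm z ^ n \<le> ((1 + A) * T) ^ n" by (intro power_mono) auto
      hence nz: "norm z ^ n \<le> (1 + A) ^ n * T ^ n" by (simp add: power_mult_distrib)
      have Pz: "\<epsilon> * (T ^ Suc n / 2) \<le> \<epsilon> * Re (P z)"
        using \<epsilon> P[of z] z T1 by (intro mult_left_mono) (auto simp: m_def)
      have "norm (F z) \<le> (\<bar>C\<bar> * exp (norm z ^ n)) * exp (- \<epsilon> * Re (P z))"
        unfolding norm_F using growth[of z] z T1
        by (intro mult_right_mono) (auto intro: order.trans mult_right_mono)
      also have "\<dots> = \<bar>C\<bar> * exp (norm z ^ n - \<epsilon> * Re (P z))" by (simp add: exp_diff exp_minus field_simps)
      also have "\<dots> \<le> \<bar>C\<bar> * exp ((1 + A) ^ n * T ^ n - \<epsilon> * (T ^ Suc n / 2))"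
        using nz Pz by (intro mult_left_mono) auto
      finally show ?thesis using T by linarith
    qed
    define S where "S = cbox (Complex a 1) (Complex b T)"
    have S: "z \<in> S \<longleftrightarrow> a \<le> Re z \<and> Re z \<le> b \<and> 1 \<le> Im z \<and> Im z \<le> T" for z
      by (auto simp: S_def in_cbox_complex_iff)
    have holF: "F holomorphic_on {s. Im s > 0}"
      unfolding F_def P_def by (intro holomorphic_intros hol)
    have "norm (F s) \<le> B"
    proof (rule maximum_modulus_frontier[of F S])
      show "F holomorphic_on interior S"
        by (rule holomorphic_on_subset[OF holF]) (use interior_subset[of S] S in fastforce)
      have "closed S" unfolding S_def by (rule closed_cbox)
      thus "continuous_on (closure S) F"
        by (auto intro!: holomorphic_on_imp_continuous_on holomorphic_on_subset[OF holF] simp: S)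
      show "bounded S" by (simp add: S_def)
      show "s \<in> S" using s T by (simp add: S)
      fix z assume "z \<in> frontier S"
      hence "z \<in> S" and "z \<notin> box (Complex a 1) (Complex b T)"
        unfolding S_def frontier_cbox by auto
      hence z: "a \<le> Re z" "Re z \<le> b" "1 \<le> Im z" and "Re z = a \<or> Re z = b \<or> Im z = 1 \<or> Im z = T"
        by (auto simp: S in_box_complex_iff)
      from this(4) show "norm (F z) \<le> B"
        using top[OF z(1,2)] F_le[OF z] left[OF _ z(3)] right[OF _ z(3)] bottom[OF z(1,2)] by fastforce
    qed
    thus ?thesis by (simp add: norm_F)
  qed
  hence "eventually (\<lambda>\<epsilon>. norm (f s) * exp (- \<epsilon> * Re (P s)) \<le> B) (at_right 0)"
    by (auto simp: eventually_at_right_less eventually_at_filter)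
  moreover have "((\<lambda>\<epsilon>. norm (f s) * exp (- \<epsilon> * Re (P s))) \<longlongrightarrow> norm (f s) * exp (- 0 * Re (P s))) (at_right 0)"
    by (intro tendsto_intros)
  ultimately show ?thesis
    using tendsto_upperbound[of "\<lambda>\<epsilon>. norm (f s) * exp (- \<epsilon> * Re (P s))" _ "at_right 0" B] by simp
qed

text \<open>Multiplication by \<open>h\<close>, of size Im s to the power -l(Re s) with l
  interpolating linearly between \<open>e1\<close> and \<open>e2\<close>, turns both edge bounds
  into constants. The upper bound on \<open>h\<close> is used on the edges; the lower bound recovers
  \<open>f\<close> inside. Nonnegative exponents make l \<ge> 0, so that norm s and Im s can be
  exchanged at bounded cost.\<close>

lemma phragmen_lindelof_convexity:
  fixes f :: "complex \<Rightarrow> complex" and a b C C1 C2 e1 e2 :: real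
  assumes hol: "f holomorphic_on {s. Im s > 0}"
    and growth: "\<And>s. \<lbrakk>a \<le> Re s; Re s \<le> b; Im s \<ge> 1\<rbrakk> \<Longrightarrow> norm (f s) \<le> C * exp (norm s ^ n)"
    and left: "\<And>s. \<lbrakk>Re s = a; Im s \<ge> 1\<rbrakk> \<Longrightarrow> norm (f s) \<le> C1 * Im s powr e1"
    and right: "\<And>s. \<lbrakk>Re s = b; Im s \<ge> 1\<rbrakk> \<Longrightarrow> norm (f s) \<le> C2 * Im s powr e2"
    and ab: "a < b" and e: "e1 \<ge> 0" "e2 \<ge> 0"
  obtains B where "B > 0"
    "\<And>s. \<lbrakk>a \<le> Re s; Re s \<le> b; Im s \<ge> 1\<rbrakk> \<Longrightarrow>
       norm (f s) \<le> B * Im s powr (e1 + (e2 - e1) * (Re s - a) / (b - a))"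
proof -
  define M where "M = max \<bar>a\<bar> \<bar>b\<bar>"
  define A where "A = (e2 - e1) / (b - a)"
  define l where "l \<sigma> = e1 + A * (\<sigma> - a)" for \<sigma>
  \<comment> \<open>\<open>norm (h s)\<close> is comparable to \<open>Im s powr (- l (Re s))\<close>: the imaginary part of the exponent's
      first factor is \<open>A * Im s\<close>, but the argument of \<open>- \<i> * s\<close> is only \<open>O(1 / Im s)\<close>.\<close>
  define h where "h s = exp (- (of_real e1 + of_real A * (s - of_real a)) * Ln (- \<i> * s))" for s
  have M: "M \<ge> 0" by (simp add: M_def)
  have l_ab: "l a = e1" "l b = e2" using ab by (auto simp: l_def A_def)
  have l_alt: "l \<sigma> = (1 - (\<sigma> - a) / (b - a)) * e1 + ((\<sigma> - a) / (b - a)) * e2" for \<sigma>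
    by (simp add: l_def A_def algebra_simps diff_divide_distrib)
  have l: "0 \<le> l \<sigma>" "l \<sigma> \<le> e1 + e2" if \<sigma>: "a \<le> \<sigma>" "\<sigma> \<le> b" for \<sigma>
  proof -
    have q: "0 \<le> (\<sigma> - a) / (b - a)" "(\<sigma> - a) / (b - a) \<le> 1" using \<sigma> ab by auto
    show "0 \<le> l \<sigma>" unfolding l_alt using q e by (intro add_nonneg_nonneg mult_nonneg_nonneg) auto
    show "l \<sigma> \<le> e1 + e2" unfolding l_alt using q e
      by (intro add_mono mult_left_le_one_le) auto
  qed
  have h: "norm (h s) \<le> exp (\<bar>A\<bar> * M) * Im s powr (- l (Re s))"
    "norm (h s) \<ge> exp (- \<bar>A\<bar> * M) * (1 + M) powr (- (e1 + e2)) * Im s powr (- l (Re s))"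
    if s: "a \<le> Re s" "Re s \<le> b" "Im s \<ge> 1" for s
  proof -
    define \<theta> where "\<theta> = Im (Ln (- \<i> * s))"
    have s0: "- \<i> * s \<noteq> 0" "s \<noteq> 0" using s by auto
    have "\<theta> = arctan (- Re s / Im s)"
      unfolding \<theta>_def using s s0 arg_conv_arctan[of "- \<i> * s"] by (simp add: Arg_eq_Im_Ln)
    hence "\<bar>\<theta>\<bar> \<le> \<bar>Re s\<bar> / Im s" using abs_arctan_le[of "- Re s / Im s"] s by simp
    also have "\<dots> \<le> M / Im s" using s by (intro divide_right_mono) (auto simp: M_def)
    finally have \<theta>: "Im s * \<bar>\<theta>\<bar> \<le> M" using s by (simp add: field_simps)
    have "Re (Ln (- \<i> * s)) = ln (norm s)" using s0 by (simp add: norm_mult)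
    hence "Re (- (of_real e1 + of_real A * (s - of_real a)) * Ln (- \<i> * s)) =
        - l (Re s) * ln (norm s) + A * (Im s * \<theta>)"
      by (simp add: \<theta>_def l_def algebra_simps)
    hence nh: "norm (h s) = norm s powr (- l (Re s)) * exp (A * (Im s * \<theta>))"
      using s0 by (simp add: h_def powr_def exp_add exp_minus exp_diff divide_simps)
    have "\<bar>A * (Im s * \<theta>)\<bar> \<le> \<bar>A\<bar> * M"
      unfolding abs_mult using \<theta> s by (intro mult_left_mono) auto
    hence ex: "exp (A * (Im s * \<theta>)) \<le> exp (\<bar>A\<bar> * M)" "exp (- \<bar>A\<bar> * M) \<le> exp (A * (Im s * \<theta>))"
      by auto
    have ns: "Im s \<le> norm s" using abs_Im_le_cmod[of s] by linarith
    hence 1: "norm s powr (- l (Re s)) \<le> Im s powr (- l (Re s))"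
      using s l[OF s(1,2)] by (intro powr_mono2') auto
    have "norm s \<le> \<bar>Re s\<bar> + \<bar>Im s\<bar>" by (rule cmod_le)
    also have "\<dots> \<le> M * Im s + Im s"
    proof (intro add_mono)
      have "\<bar>Re s\<bar> \<le> M * 1" using s by (auto simp: M_def)
      also have "\<dots> \<le> M * Im s" using s M by (intro mult_left_mono) auto
      finally show "\<bar>Re s\<bar> \<le> M * Im s" .
    qed (use s in auto)
    finally have "norm s \<le> (1 + M) * Im s" by (simp add: algebra_simps)
    hence "norm s powr (- l (Re s)) \<ge> ((1 + M) * Im s) powr (- l (Re s))"
      using s l[OF s(1,2)] s0 by (intro powr_mono2') auto
    moreover have "(1 + M) powr (- (e1 + e2)) * Im s powr (- l (Re s)) \<le>
        (1 + M) powr (- l (Re s)) * Im s powr (- l (Re s))"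
      using l[OF s(1,2)] M by (intro mult_right_mono powr_mono) auto
    moreover have "(1 + M) powr (- l (Re s)) * Im s powr (- l (Re s)) = ((1 + M) * Im s) powr (- l (Re s))"
      using M s by (simp add: powr_mult)
    ultimately have 2: "(1 + M) powr (- (e1 + e2)) * Im s powr (- l (Re s)) \<le> norm s powr (- l (Re s))"
      by simp
    show "norm (h s) \<le> exp (\<bar>A\<bar> * M) * Im s powr (- l (Re s))"
      unfolding nh using mult_mono[OF 1 ex(1)] by (simp add: mult.commute)
    show "norm (h s) \<ge> exp (- \<bar>A\<bar> * M) * (1 + M) powr (- (e1 + e2)) * Im s powr (- l (Re s))"
      unfolding nh using mult_mono[OF ex(2) 2] by (simp add: mult_ac)
  qed
  have hol_g: "(\<lambda>s. f s * h s) holomorphic_on {s. Im s > 0}"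
    unfolding h_def by (intro holomorphic_intros hol) (auto simp: complex_nonpos_Reals_iff)
  have "compact (cbox (Complex a 1) (Complex b 1))" by simp
  moreover have "continuous_on (cbox (Complex a 1) (Complex b 1)) (\<lambda>s. f s * h s)"
    by (intro holomorphic_on_imp_continuous_on holomorphic_on_subset[OF hol_g])
       (auto simp: in_cbox_complex_iff)
  ultimately have "bounded ((\<lambda>s. f s * h s) ` cbox (Complex a 1) (Complex b 1))"
    by (intro compact_imp_bounded compact_continuous_image)
  then obtain C0 where "\<forall>s\<in>cbox (Complex a 1) (Complex b 1). norm (f s * h s) \<le> C0"
    by (auto simp: bounded_iff)
  hence C0: "\<And>s. \<lbrakk>a \<le> Re s; Re s \<le> b; Im s = 1\<rbrakk> \<Longrightarrow> norm (f s * h s) \<le> C0"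
    by (auto simp: in_cbox_complex_iff)
  define B where "B = \<bar>C0\<bar> + exp (\<bar>A\<bar> * M) * \<bar>C1\<bar> + exp (\<bar>A\<bar> * M) * \<bar>C2\<bar> + 1"
  have B: "B > 0" "B \<ge> C0" "B \<ge> exp (\<bar>A\<bar> * M) * \<bar>C1\<bar>" "B \<ge> exp (\<bar>A\<bar> * M) * \<bar>C2\<bar>"
  proof -
    have "exp (\<bar>A\<bar> * M) * \<bar>C1\<bar> \<ge> 0" "exp (\<bar>A\<bar> * M) * \<bar>C2\<bar> \<ge> 0" by auto
    thus "B > 0" "B \<ge> C0" "B \<ge> exp (\<bar>A\<bar> * M) * \<bar>C1\<bar>" "B \<ge> exp (\<bar>A\<bar> * M) * \<bar>C2\<bar>"
      unfolding B_def by linarith+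
  qed
  have edge: "norm (f s * h s) \<le> exp (\<bar>A\<bar> * M) * \<bar>D\<bar>"
    if "norm (f s) \<le> D * Im s powr l (Re s)" "a \<le> Re s" "Re s \<le> b" "Im s \<ge> 1" for s D
  proof -
    have "norm (f s) \<le> \<bar>D\<bar> * Im s powr l (Re s)"
      by (rule order.trans[OF that(1)]) (intro mult_right_mono, auto)
    hence "norm (f s * h s) \<le> (\<bar>D\<bar> * Im s powr l (Re s)) * (exp (\<bar>A\<bar> * M) * Im s powr (- l (Re s)))"
      unfolding norm_mult using that by (intro mult_mono h) auto
    also have "\<dots> = exp (\<bar>A\<bar> * M) * \<bar>D\<bar>" using that by (simp add: powr_minus field_simps)
    finally show ?thesis .
  qed
  have main: "norm (f s * h s) \<le> B" if s: "a \<le> Re s" "Re s \<le> b" "Im s \<ge> 1" for s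
  proof (rule phragmen_lindelof_half_strip[OF hol_g _ _ _ _ B(1) s])
    fix s :: complex assume s: "a \<le> Re s" "Re s \<le> b" "Im s \<ge> 1"
    have "norm (h s) \<le> exp (\<bar>A\<bar> * M) * Im s powr (- l (Re s))" by (rule h[OF s])
    also have "\<dots> \<le> exp (\<bar>A\<bar> * M) * Im s powr 0"
      using l[OF s(1,2)] s by (intro mult_left_mono powr_mono) auto
    finally have "norm (h s) \<le> exp (\<bar>A\<bar> * M)" using s by simp
    hence "norm (f s * h s) \<le> (C * exp (norm s ^ n)) * exp (\<bar>A\<bar> * M)"
      unfolding norm_mult using growth[OF s] order.trans[OF norm_ge_zero growth[OF s]] by (intro mult_mono) auto
    thus "norm (f s * h s) \<le> (C * exp (\<bar>A\<bar> * M)) * exp (norm s ^ n)" by (simp add: mult_ac)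
  next
    fix s :: complex assume s: "Re s = a" "Im s \<ge> 1"
    show "norm (f s * h s) \<le> B"
      using edge[of s C1] left[OF s] s ab l_ab B by auto
  next
    fix s :: complex assume s: "Re s = b" "Im s \<ge> 1"
    show "norm (f s * h s) \<le> B"
      using edge[of s C2] right[OF s] s ab l_ab B by auto
  next
    fix s :: complex assume "a \<le> Re s" "Re s \<le> b" "Im s = 1"
    thus "norm (f s * h s) \<le> B" using C0[of s] B by auto
  qed
  define c where "c = exp (- \<bar>A\<bar> * M) * (1 + M) powr (- (e1 + e2))"
  have c: "c > 0" using M by (simp add: c_def)
  show ?thesis
  proof (rule that[of "B / c"])
    show "B / c > 0" using B c by simp
    fix s :: complex assume s: "a \<le> Re s" "Re s \<le> b" "Im s \<ge> 1"
    have "norm (f s) * (c * Im s powr (- l (Re s))) \<le> norm (f s) * norm (h s)"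
      using h(2)[OF s] by (intro mult_left_mono) (auto simp: c_def)
    also have "\<dots> \<le> B" using main[OF s] by (simp add: norm_mult)
    finally have "norm (f s) \<le> B / c * Im s powr (l (Re s))"
      using c s by (simp add: powr_minus field_simps)
    thus "norm (f s) \<le> B / c * Im s powr (e1 + (e2 - e1) * (Re s - a) / (b - a))"
      by (simp add: l_def A_def)
  qed
qed

subsection \<open>The functional equation and the Dirichlet series\<close>

text \<open>In norms the functional equation loses \<omega> and the conjugation. The j-th Gamma
  quotient compares real parts that differ by lam j (1 - 2\<sigma>), and these exponents add up to
  the degree times (1/2 - \<sigma>). A one-sided estimate is enough, since applying it at 1 -
  \<sigma> gives the reverse one.\<close>

lemma functional_equation_bigo:
  fixes f :: "complex \<Rightarrow> complex" and \<sigma> :: real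
  assumes fe: "satisfies_functional_equation f Q r lam mu \<omega>"
  shows "(\<lambda>t. norm (f (Complex \<sigma> t)))
    \<in> O(\<lambda>t. t powr (2 * (\<Sum>j=1..r. lam j) * (1 / 2 - \<sigma>)) * norm (f (Complex (1 - \<sigma>) t)))"
proof -
  define z where "z \<sigma> j t = Complex (lam j * \<sigma> + Re (mu j)) (lam j * t + Im (mu j))" for \<sigma> j t
  define R where "R j t = norm (Gamma (z (1 - \<sigma>) j t)) / norm (Gamma (z \<sigma> j t))" for j t
  have Q: "Q > 0" and \<omega>: "norm \<omega> = 1" and "\<forall>j\<in>{1..r}. lam j > 0 \<and> Re (mu j) \<ge> 0"
    using fe unfolding satisfies_functional_equation_def by blast+
  hence lam: "\<And>j. j \<in> {1..r} \<Longrightarrow> lam j > 0" by blast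
  have FE: "completed f Q r lam mu s = \<omega> * cnj (completed f Q r lam mu (1 - cnj s))"
    if "s \<notin> {0, 1}" "\<And>j. j \<in> {1..r} \<Longrightarrow> of_real (lam j) * s + mu j \<notin> \<int>\<^sub>\<le>\<^sub>0"
      "\<And>j. j \<in> {1..r} \<Longrightarrow> of_real (lam j) * (1 - cnj s) + mu j \<notin> \<int>\<^sub>\<le>\<^sub>0" for s
  proof -
    have "\<forall>s. s \<notin> {0, 1} \<and>
          (\<forall>j\<in>{1..r}. of_real (lam j) * s + mu j \<notin> \<int>\<^sub>\<le>\<^sub>0 \<and>
                      of_real (lam j) * (1 - cnj s) + mu j \<notin> \<int>\<^sub>\<le>\<^sub>0) \<longrightarrow>
          completed f Q r lam mu s = \<omega> * cnj (completed f Q r lam mu (1 - cnj s))"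
      using fe unfolding satisfies_functional_equation_def by (elim conjE)
    thus ?thesis using that by blast
  qed
  \<comment> \<open>Far enough up, every Gamma argument has imaginary part at least 1. This avoids
    all points excluded from the functional equation and meets the height condition of
    \<open>norm_Gamma_ratio_bound\<close>.\<close>
  have large: "eventually (\<lambda>t. lam j * t + Im (mu j) \<ge> 1) at_top" if "j \<in> {1..r}" for j
    using lam[OF that] by real_asymp
  have z_ok: "z \<sigma> j t \<notin> \<int>\<^sub>\<le>\<^sub>0" if "lam j * t + Im (mu j) \<ge> 1" for \<sigma> j t
    using that by (auto elim!: nonpos_Ints_cases simp: z_def complex_eq_iff)
  have ratio: "R j \<in> O(\<lambda>t. t powr (lam j * (1 - 2 * \<sigma>)))" if j: "j \<in> {1..r}" for j
  proof -
    obtain K where K: "\<And>y. y \<ge> 1 \<Longrightarrow> norm (Gamma (Complex (lam j * (1 - \<sigma>) + Re (mu j)) y)) \<le>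
        K * y powr ((lam j * (1 - \<sigma>) + Re (mu j)) - (lam j * \<sigma> + Re (mu j))) * norm (Gamma (Complex (lam j * \<sigma> + Re (mu j)) y))"
      using norm_Gamma_ratio_bound by metis
    have "R j \<in> O(\<lambda>t. (lam j * t + Im (mu j)) powr (lam j * (1 - 2 * \<sigma>)))"
    proof (rule bigoI)
      show "eventually (\<lambda>t. norm (R j t) \<le> K * norm ((lam j * t + Im (mu j)) powr (lam j * (1 - 2 * \<sigma>)))) at_top"
        using large[OF j]
      proof eventually_elim
        case (elim t)
        have "norm (Gamma (z \<sigma> j t)) > 0" using z_ok[OF elim] by (auto simp: Gamma_eq_zero_iff)
        thus ?case using K[OF elim] by (simp add: R_def z_def divide_le_eq algebra_simps)
      qed
    qed
    also have "(\<lambda>t. (lam j * t + Im (mu j)) powr (lam j * (1 - 2 * \<sigma>))) \<in> O(\<lambda>t. t powr (lam j * (1 - 2 * \<sigma>)))"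
      using lam[OF j] by real_asymp
    finally show ?thesis .
  qed
  have "(\<lambda>t. \<Prod>j=1..r. R j t) \<in> O(\<lambda>t. \<Prod>j=1..r. t powr (lam j * (1 - 2 * \<sigma>)))"
    by (rule landau_o.big_prod) (rule ratio)
  also have "(\<lambda>t. \<Prod>j=1..r. t powr (lam j * (1 - 2 * \<sigma>))) \<in> \<Theta>(\<lambda>t. t powr (2 * (\<Sum>j=1..r. lam j) * (1 / 2 - \<sigma>)))"
  proof (rule bigthetaI_cong)
    show "eventually (\<lambda>t. (\<Prod>j=1..r. t powr (lam j * (1 - 2 * \<sigma>))) = t powr (2 * (\<Sum>j=1..r. lam j) * (1 / 2 - \<sigma>))) at_top"
      using eventually_gt_at_top[of 0]
    proof eventually_elim
      case (elim t)
      have "(\<Prod>j=1..r. t powr (lam j * (1 - 2 * \<sigma>))) = t powr (\<Sum>j=1..r. lam j * (1 - 2 * \<sigma>))"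
        using elim by (subst powr_sum) auto
      also have "(\<Sum>j=1..r. lam j * (1 - 2 * \<sigma>)) = 2 * (\<Sum>j=1..r. lam j) * (1 / 2 - \<sigma>)"
        by (subst sum_distrib_right[symmetric]) (simp add: algebra_simps)
      finally show ?case .
    qed
  qed
  finally have prod: "(\<lambda>t. \<Prod>j=1..r. R j t) \<in> O(\<lambda>t. t powr (2 * (\<Sum>j=1..r. lam j) * (1 / 2 - \<sigma>)))" .
  have "eventually (\<lambda>t. norm (f (Complex \<sigma> t)) = Q powr (1 - 2 * \<sigma>) * ((\<Prod>j=1..r. R j t) * norm (f (Complex (1 - \<sigma>) t)))) at_top"
  proof -
    have "eventually (\<lambda>t. \<forall>j\<in>{1..r}. lam j * t + Im (mu j) \<ge> 1) at_top"
      using large by (subst eventually_ball_finite_distrib) auto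
    thus ?thesis using eventually_gt_at_top[of 0]
    proof eventually_elim
      case (elim t)
      define s where "s = Complex \<sigma> t"
      have zs: "of_real (lam j) * s + mu j = z \<sigma> j t" "of_real (lam j) * (1 - cnj s) + mu j = z (1 - \<sigma>) j t" for j
        by (auto simp: s_def z_def complex_eq_iff)
      have s1: "1 - cnj s = Complex (1 - \<sigma>) t" by (simp add: s_def complex_eq_iff)
      have "s \<notin> {0, 1}" using elim by (auto simp: s_def complex_eq_iff)
      hence "completed f Q r lam mu s = \<omega> * cnj (completed f Q r lam mu (1 - cnj s))"
        by (rule FE) (use elim in \<open>auto simp only: zs intro!: z_ok\<close>)
      hence "norm (completed f Q r lam mu s) = norm (completed f Q r lam mu (1 - cnj s))"
        using \<omega> by (simp add: norm_mult)
      hence eq: "Q powr \<sigma> * (\<Prod>j=1..r. norm (Gamma (z \<sigma> j t))) * norm (f s) =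
             Q powr (1 - \<sigma>) * (\<Prod>j=1..r. norm (Gamma (z (1 - \<sigma>) j t))) * norm (f (Complex (1 - \<sigma>) t))"
        using Q unfolding completed_def zs by (simp add: norm_mult prod_norm norm_powr_real_powr s_def s1[unfolded s_def])
      have pos: "(\<Prod>j=1..r. norm (Gamma (z \<sigma> j t))) > 0"
        using z_ok elim by (intro prod_pos) (auto simp: Gamma_eq_zero_iff)
      have "x = b / a * (q / p * y)" if "a * p * x = b * q * y" "p > 0" "a > 0" for a b p q x y :: real
        using that by (simp add: field_simps)
      from this[OF eq pos] have "norm (f s) = Q powr (1 - \<sigma>) / Q powr \<sigma> *
          ((\<Prod>j=1..r. R j t) * norm (f (Complex (1 - \<sigma>) t)))"
        using Q unfolding R_def prod_dividef by simp
      moreover have "Q powr (1 - 2 * \<sigma>) = Q powr (1 - \<sigma>) / Q powr \<sigma>"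
        by (simp add: powr_diff[symmetric])
      ultimately show ?case by (simp only: s_def)
    qed
  qed
  hence "(\<lambda>t. norm (f (Complex \<sigma> t))) \<in> \<Theta>(\<lambda>t. Q powr (1 - 2 * \<sigma>) * ((\<Prod>j=1..r. R j t) * norm (f (Complex (1 - \<sigma>) t))))"
    by (rule bigthetaI_cong)
  also have "(\<lambda>t. Q powr (1 - 2 * \<sigma>) * ((\<Prod>j=1..r. R j t) * norm (f (Complex (1 - \<sigma>) t)))) \<in>
     O(\<lambda>t. t powr (2 * (\<Sum>j=1..r. lam j) * (1 / 2 - \<sigma>)) * norm (f (Complex (1 - \<sigma>) t)))"
    using landau_o.big.mult[OF prod landau_o.big_refl[of "\<lambda>t. norm (f (Complex (1 - \<sigma>) t))"]] Q
    by (subst landau_o.big.cmult_in_iff) auto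
  finally show ?thesis .
qed

lemma norm_dirichlet_term:
  assumes "n \<ge> 1"
  shows "norm (c / of_nat n powr s) = norm c / real n powr Re s"
  using assms by (simp add: norm_divide norm_powr_real_powr)

lemma dirichlet_series_bounded:
  assumes "has_dirichlet_series f" and "\<sigma> > 1"
  obtains B where "\<And>s. Re s = \<sigma> \<Longrightarrow> norm (f s) \<le> B"
proof -
  obtain c where c: "\<And>s. Re s > 1 \<Longrightarrow> (\<lambda>n. norm (c n / of_nat n powr s)) summable_on {1..}"
    "\<And>s. Re s > 1 \<Longrightarrow> ((\<lambda>n. c n / of_nat n powr s) has_sum f s) {1..}"
    using assms(1) unfolding has_dirichlet_series_def by blast
  show ?thesis
  proof (rule that)
    fix s assume s: "Re s = \<sigma>"
    have "norm (f s) = norm (\<Sum>\<^sub>\<infinity>n\<in>{1..}. c n / of_nat n powr s)"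
      using c(2)[of s] s assms(2) by (simp add: infsumI)
    also have "\<dots> \<le> (\<Sum>\<^sub>\<infinity>n\<in>{1..}. norm (c n / of_nat n powr s))"
      using c(1)[of s] s assms(2) by (intro norm_infsum_bound) auto
    also have "\<dots> = (\<Sum>\<^sub>\<infinity>n\<in>{1..}. norm (c n) / real n powr \<sigma>)"
      using s by (intro infsum_cong) (simp add: norm_dirichlet_term)
    finally show "norm (f s) \<le> (\<Sum>\<^sub>\<infinity>n\<in>{1..}. norm (c n) / real n powr \<sigma>)" .
  qed
qed

text \<open>With \<open>N\<close> the first index of a nonzero coefficient, multiplying by N^s makes
  the first term constant. Every later term carries a factor (N/n)^(Re s), so the tail tends to 0
  uniformly as Re s grows.\<close>

lemma dirichlet_series_leading_term:
  assumes ds: "has_dirichlet_series f" and nz: "\<exists>s. Re s > 1 \<and> f s \<noteq> 0"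
  obtains N :: nat and a \<sigma>0 where "N \<ge> 1" "a \<noteq> 0" "\<sigma>0 > 1"
    "\<And>s. Re s \<ge> \<sigma>0 \<Longrightarrow> norm (f s * of_nat N powr s - a) \<le> norm a / 2"
proof -
  obtain c where c: "\<And>s. Re s > 1 \<Longrightarrow> (\<lambda>n. norm (c n / of_nat n powr s)) summable_on {1..}"
    "\<And>s. Re s > 1 \<Longrightarrow> ((\<lambda>n. c n / of_nat n powr s) has_sum f s) {1..}"
    using ds unfolding has_dirichlet_series_def by blast
  have "\<exists>n. n \<ge> 1 \<and> c n \<noteq> 0"
  proof (rule ccontr)
    assume "\<nexists>n. n \<ge> 1 \<and> c n \<noteq> 0"
    hence z: "\<And>n. n \<ge> 1 \<Longrightarrow> c n = 0" by blast
    have "f s = 0" if "Re s > 1" for s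
    proof -
      have "((\<lambda>n. c n / of_nat n powr s) has_sum 0) {1..}"
        by (rule has_sum_0) (use z in auto)
      thus ?thesis using c(2)[OF that] has_sum_unique by blast
    qed
    thus False using nz by blast
  qed
  define N where "N = (LEAST n. n \<ge> 1 \<and> c n \<noteq> 0)"
  have N: "N \<ge> 1" "c N \<noteq> 0"
    using LeastI_ex[OF \<open>\<exists>n. n \<ge> 1 \<and> c n \<noteq> 0\<close>] by (auto simp: N_def)
  have below: "c n = 0" if "n \<ge> 1" "n < N" for n
    using not_less_Least[of n "\<lambda>n. n \<ge> 1 \<and> c n \<noteq> 0"] that unfolding N_def by blast
  \<comment> \<open>\<open>W\<close> is the normalised tail in absolute values at real part 2, and
    \<open>q\<close> is the largest ratio N/n with n > N. Splitting Re s = 2 + (Re s - 2) bounds the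
    tail by \<open>W\<close> times q^(Re s - 2).\<close>
  define W where "W = (\<Sum>\<^sub>\<infinity>n\<in>{N<..}. norm (c n) / real n powr 2 * real N powr 2)"
  define q where "q = real N / real (Suc N)"
  have q: "0 < q" "q < 1" using N by (auto simp: q_def)
  have summ: "(\<lambda>n. norm (c n) / real n powr \<sigma>) summable_on {1..}" if "\<sigma> > 1" for \<sigma>
  proof -
    have "(\<lambda>n. norm (c n / of_nat n powr of_real \<sigma>)) summable_on {1..}" using that by (intro c(1)) auto
    also have "?this \<longleftrightarrow> ?thesis"
      by (intro summable_on_cong) (simp only: atLeast_iff norm_dirichlet_term Re_complex_of_real)
    finally show ?thesis .
  qed
  have summ2: "(\<lambda>n. norm (c n) / real n powr \<sigma> * x) summable_on {N<..}" if "\<sigma> > 1" for \<sigma> x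
    by (intro summable_on_cmult_left summable_on_subset_banach[OF summ[OF that]]) auto
  have bound: "norm (f s * of_nat N powr s - c N) \<le> q powr (Re s - 2) * W" if s: "Re s \<ge> 2" for s
  proof -
    have "((\<lambda>n. c n / of_nat n powr s * of_nat N powr s) has_sum f s * of_nat N powr s) {1..}"
      using s by (intro has_sum_cmult_left c(2)) auto
    also have "?this \<longleftrightarrow> ((\<lambda>n. c n / of_nat n powr s * of_nat N powr s) has_sum f s * of_nat N powr s) {N..}"
      using N below by (intro has_sum_cong_neutral) auto
    finally have 1: "((\<lambda>n. c n / of_nat n powr s * of_nat N powr s) has_sum f s * of_nat N powr s) {N..}" .
    have "((\<lambda>n. c n / of_nat n powr s * of_nat N powr s) has_sum (c N / of_nat N powr s * of_nat N powr s)) {N}"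
      by (intro has_sum_finiteI) auto
    from has_sum_Diff[OF 1 this]
    have "((\<lambda>n. c n / of_nat n powr s * of_nat N powr s) has_sum
        (f s * of_nat N powr s - c N / of_nat N powr s * of_nat N powr s)) ({N..} - {N})"
      by simp
    moreover have "{N..} - {N} = {N<..}" by auto
    moreover have "c N / of_nat N powr s * of_nat N powr s = c N" using N by simp
    ultimately have hs: "((\<lambda>n. c n / of_nat n powr s * of_nat N powr s) has_sum (f s * of_nat N powr s - c N)) {N<..}"
      by simp
    have nt: "norm (c n / of_nat n powr s * of_nat N powr s) = norm (c n) / real n powr Re s * real N powr Re s"
      if "n \<in> {N<..}" for n
      using that N unfolding norm_mult by (subst norm_dirichlet_term) (auto simp: norm_powr_real_powr)
    have sn: "(\<lambda>n. norm (c n / of_nat n powr s * of_nat N powr s)) summable_on {N<..}"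
      by (subst summable_on_cong[OF nt]) (use summ2[of "Re s"] s in auto)
    have "norm (f s * of_nat N powr s - c N) \<le> (\<Sum>\<^sub>\<infinity>n\<in>{N<..}. norm (c n / of_nat n powr s * of_nat N powr s))"
      using norm_infsum_bound[OF sn] infsumI[OF hs] by simp
    also have "\<dots> \<le> (\<Sum>\<^sub>\<infinity>n\<in>{N<..}. q powr (Re s - 2) * (norm (c n) / real n powr 2 * real N powr 2))"
    proof (intro infsum_mono sn summable_on_cmult_right summ2)
      fix n assume n: "n \<in> {N<..}"
      have "real N / real n \<le> q" unfolding q_def using n N by (intro divide_left_mono) auto
      hence "(real N / real n) powr (Re s - 2) \<le> q powr (Re s - 2)"
        using s by (intro powr_mono2) auto
      hence "(norm (c n) * (real N / real n) powr 2) * (real N / real n) powr (Re s - 2) \<le> (norm (c n) * (real N / real n) powr 2) * q powr (Re s - 2)"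
        by (intro mult_left_mono) auto
      moreover have "norm (c n / of_nat n powr s * of_nat N powr s) = norm (c n) * ((real N / real n) powr 2 * (real N / real n) powr (Re s - 2))"
        unfolding nt[OF n] powr_add[symmetric] by (simp add: powr_divide)
      moreover have "(real N / real n) powr 2 = real N powr 2 / real n powr 2" by (simp add: powr_divide)
      ultimately show "norm (c n / of_nat n powr s * of_nat N powr s) \<le> q powr (Re s - 2) * (norm (c n) / real n powr 2 * real N powr 2)"
        by (simp add: mult_ac)
    qed auto
    also have "\<dots> = q powr (Re s - 2) * W" unfolding W_def by (rule infsum_cmult_right')
    finally show ?thesis .
  qed
  have W: "W \<ge> 0" unfolding W_def by (intro infsum_nonneg) auto
  have "((\<lambda>x. q powr (x - 2) * W) \<longlongrightarrow> 0) at_top"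
    using q by real_asymp
  hence "eventually (\<lambda>x. q powr (x - 2) * W < norm (c N) / 2) at_top"
    by (rule order_tendstoD) (use N in auto)
  hence "eventually (\<lambda>x. q powr (x - 2) * W < norm (c N) / 2 \<and> x \<ge> 2) at_top"
    using eventually_ge_at_top[of 2] by eventually_elim auto
  then obtain x where x: "q powr (x - 2) * W < norm (c N) / 2" "x \<ge> 2"
    by (auto simp: eventually_at_top_linorder)
  show ?thesis
  proof (rule that[of N "c N" x])
    fix s :: complex assume s: "Re s \<ge> x"
    have "norm (f s * of_nat N powr s - c N) \<le> q powr (Re s - 2) * W"
      using s x by (intro bound) auto
    also have "\<dots> \<le> q powr (x - 2) * W"
      using s q W by (intro mult_right_mono powr_mono') auto
    finally show "norm (f s * of_nat N powr s - c N) \<le> norm (c N) / 2" using x by simp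
  qed (use N x in auto)
qed

lemma continuation_properties:
  assumes "has_continuation f"
  shows "f holomorphic_on {s. Im s > 0}"
    and "\<exists>C n. \<forall>s. Im s \<ge> 1 \<longrightarrow> norm (f s) \<le> C * exp (norm s ^ n)"
    and "\<lbrakk>\<And>s. Re s > 1 \<Longrightarrow> f s = 0; s \<noteq> 1\<rbrakk> \<Longrightarrow> f s = 0"
proof -
  obtain m g C \<rho> where g: "\<And>s. s \<noteq> 1 \<Longrightarrow> g s = (s - 1) ^ m * f s" "g holomorphic_on UNIV"
    "\<And>s. norm (g s) \<le> C * exp (norm s powr \<rho>)"
    using assms unfolding has_continuation_def entire_of_finite_order_def by metis
  have f: "f s = g s / (s - 1) ^ m" if "s \<noteq> 1" for s
    using g(1)[OF that] that by simp
  show "f holomorphic_on {s. Im s > 0}"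
  proof (rule holomorphic_transform)
    show "(\<lambda>s. g s / (s - 1) ^ m) holomorphic_on {s. Im s > 0}"
      by (intro holomorphic_intros holomorphic_on_subset[OF g(2)]) auto
  next
    fix s :: complex assume "s \<in> {s. Im s > 0}"
    hence "s \<noteq> 1" by auto
    thus "g s / (s - 1) ^ m = f s" by (rule f[symmetric])
  qed
  \<comment> \<open>For Im s \<ge> 1 division by (s - 1)^m cannot increase the norm. Rounding \<rho>
    up to a natural number, with negative values sent to 0, is harmless because norm s \<ge>
    1.\<close>
  have "norm (f s) \<le> \<bar>C\<bar> * exp (norm s ^ nat \<lceil>\<rho>\<rceil>)" if s: "Im s \<ge> 1" for s
  proof -
    have "norm (s - 1) \<ge> 1" using abs_Im_le_cmod[of "s - 1"] s by simp
    hence "norm (s - 1) ^ m \<ge> 1" by simp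
    have ns: "norm s \<ge> 1" using abs_Im_le_cmod[of s] s by simp
    have "norm (f s) = norm (g s) / norm (s - 1) ^ m"
      using s by (subst f) (auto simp: norm_divide norm_power)
    also have "\<dots> \<le> norm (g s) / 1"
      by (rule divide_left_mono) (use \<open>norm (s - 1) ^ m \<ge> 1\<close> in auto)
    also have "\<dots> \<le> \<bar>C\<bar> * exp (norm s powr \<rho>)"
      using g(3)[of s] by (auto intro: order.trans mult_right_mono)
    also have "\<dots> \<le> \<bar>C\<bar> * exp (norm s powr real (nat \<lceil>\<rho>\<rceil>))"
      using ns by (intro mult_left_mono exp_le_cancel_iff[THEN iffD2] powr_mono) linarith+
    also have "norm s powr real (nat \<lceil>\<rho>\<rceil>) = norm s ^ nat \<lceil>\<rho>\<rceil>"
      using ns by (intro powr_realpow) auto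
    finally show ?thesis .
  qed
  thus "\<exists>C n. \<forall>s. Im s \<ge> 1 \<longrightarrow> norm (f s) \<le> C * exp (norm s ^ n)" by blast
  assume z: "\<And>s. Re s > 1 \<Longrightarrow> f s = 0" and s: "s \<noteq> 1"
  have "g s = 0"
  proof (rule analytic_continuation_open[of "{s. Re s > 1}" UNIV g "\<lambda>_. 0"])
    show "open {s. Re s > 1}" by (rule open_halfspace_Re_gt)
    have "(2::complex) \<in> {s. Re s > 1}" by simp
    thus "{s. Re s > 1} \<noteq> {}" by blast
    fix s :: complex assume "s \<in> {s. Re s > 1}"
    thus "g s = 0" using z g(1)[of s] by fastforce
  qed (use g in auto)
  thus "f s = 0" using f[OF s] by simp
qed

subsection \<open>The order function\<close>

text \<open>Only the upper half plane matters from here on, so the pole at 1 disappears. The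
  Dirichlet series is reduced to boundedness and its leading term, and the functional equation to an
  estimate in which only the degree remains.\<close>

locale strip_function =
  fixes f :: "complex \<Rightarrow> complex" and d C0 :: real and n :: nat
  assumes d_pos: "d > 0"
    and holomorphic: "f holomorphic_on {s. Im s > 0}"
    and growth: "\<And>s. Im s \<ge> 1 \<Longrightarrow> norm (f s) \<le> C0 * exp (norm s ^ n)"
    and bounded_right: "\<And>\<sigma>. \<sigma> > 1 \<Longrightarrow> \<exists>B. \<forall>t. norm (f (Complex \<sigma> t)) \<le> B"
    and leading_term: "\<exists>(N :: nat) a \<sigma>0. N \<ge> 1 \<and> a \<noteq> 0 \<and> \<sigma>0 > 1 \<and>
      (\<forall>s. Re s \<ge> \<sigma>0 \<longrightarrow> norm (f s * of_nat N powr s - a) \<le> norm a / 2)"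
    and fe_bigo: "\<And>\<sigma>. (\<lambda>t. norm (f (Complex \<sigma> t)))
      \<in> O(\<lambda>t. t powr (d * (1 / 2 - \<sigma>)) * norm (f (Complex (1 - \<sigma>) t)))"
begin

text \<open>This names the exponents whose infimum is \<open>order_function\<close>. That infimum
  need not be attained, so estimates are carried out on exponents and passed to the infimum
  afterwards.\<close>

definition admissible :: "real \<Rightarrow> real \<Rightarrow> bool" where
  "admissible \<sigma> e \<longleftrightarrow> e \<ge> 0 \<and> (\<exists>C. \<forall>t\<ge>1. norm (f (Complex \<sigma> t)) \<le> C * t powr e)"

lemma order_function_eq: "order_function f \<sigma> = Inf {e. admissible \<sigma> e}"
  unfolding order_function_def admissible_def ..

lemma continuous_on_vertical_line:
  assumes "A \<subseteq> {0<..}"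
  shows "continuous_on A (\<lambda>t. f (Complex \<sigma> t))"
proof -
  have "continuous_on A (\<lambda>t. Complex \<sigma> t)"
    unfolding Complex_eq by (intro continuous_intros)
  moreover have "Complex \<sigma> ` A \<subseteq> {s. Im s > 0}" using assms by auto
  ultimately show ?thesis
    using continuous_on_compose2[OF holomorphic_on_imp_continuous_on[OF holomorphic]] by blast
qed

text \<open>On the initial interval [1, T] continuity bounds \<open>f\<close>, and t powr e \<ge> 1
  there because e \<ge> 0, so the constant can absorb it.\<close>

lemma admissible_iff_bigo:
  assumes "e \<ge> 0"
  shows "admissible \<sigma> e \<longleftrightarrow> (\<lambda>t. norm (f (Complex \<sigma> t))) \<in> O(\<lambda>t. t powr e)"
proof
  assume "admissible \<sigma> e"
  then obtain C where C: "\<And>t. t \<ge> 1 \<Longrightarrow> norm (f (Complex \<sigma> t)) \<le> C * t powr e"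
    by (auto simp: admissible_def)
  show "(\<lambda>t. norm (f (Complex \<sigma> t))) \<in> O(\<lambda>t. t powr e)"
  proof (rule bigoI)
    show "eventually (\<lambda>t. norm (norm (f (Complex \<sigma> t))) \<le> C * norm (t powr e)) at_top"
      using eventually_ge_at_top[of 1] by eventually_elim (use C in auto)
  qed
next
  assume "(\<lambda>t. norm (f (Complex \<sigma> t))) \<in> O(\<lambda>t. t powr e)"
  then obtain C where "eventually (\<lambda>t. norm (norm (f (Complex \<sigma> t))) \<le> C * norm (t powr e)) at_top"
    by (elim landau_o.bigE)
  then obtain T where T: "\<And>t. t \<ge> T \<Longrightarrow> norm (f (Complex \<sigma> t)) \<le> C * t powr e"
    by (auto simp: eventually_at_top_linorder)
  have "compact ((\<lambda>t. f (Complex \<sigma> t)) ` {1..T})"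
    by (intro compact_continuous_image continuous_on_vertical_line) auto
  from compact_imp_bounded[OF this]
  obtain D where D: "\<forall>t\<in>{1..T}. norm (f (Complex \<sigma> t)) \<le> D"
    by (auto simp: bounded_iff)
  have "norm (f (Complex \<sigma> t)) \<le> (\<bar>C\<bar> + \<bar>D\<bar>) * t powr e" if t: "t \<ge> 1" for t
  proof (cases "t \<le> T")
    case True
    have "norm (f (Complex \<sigma> t)) \<le> \<bar>D\<bar> * 1" using D True t
      by (intro order.trans[OF bspec[OF D]]) auto
    also have "\<dots> \<le> (\<bar>C\<bar> + \<bar>D\<bar>) * t powr e"
      using t assms by (intro mult_mono ge_one_powr_ge_zero) auto
    finally show ?thesis .
  next
    case False
    hence "norm (f (Complex \<sigma> t)) \<le> C * t powr e" using T by simp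
    also have "\<dots> \<le> (\<bar>C\<bar> + \<bar>D\<bar>) * t powr e" by (intro mult_right_mono) auto
    finally show ?thesis .
  qed
  thus "admissible \<sigma> e" unfolding admissible_def using assms by blast
qed

lemma admissible_mono:
  assumes "admissible \<sigma> e" "e \<le> e'"
  shows "admissible \<sigma> e'"
proof -
  have "(\<lambda>t. t powr e) \<in> O(\<lambda>t::real. t powr e')"
  proof (rule bigoI)
    show "eventually (\<lambda>t. norm (t powr e) \<le> 1 * norm (t powr e')) at_top"
      using eventually_ge_at_top[of 1] by eventually_elim (use assms powr_mono in auto)
  qed
  moreover have "e \<ge> 0" using assms(1) by (simp add: admissible_def)
  ultimately show ?thesis
    using assms landau_o.big_trans by (auto simp: admissible_iff_bigo)
qed

lemma admissible_right: "\<sigma> > 1 \<Longrightarrow> admissible \<sigma> 0"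
  using bounded_right[of \<sigma>] by (auto simp: admissible_def)

text \<open>Stated for \<open>O\<close> rather than \<open>admissible\<close> so that the resulting
  exponent may be negative: \<open>order_function_pos\<close> needs actual decay.\<close>

lemma fe_bigo_powr:
  assumes "(\<lambda>t. norm (f (Complex (1 - \<sigma>) t))) \<in> O(\<lambda>t. t powr e)"
  shows "(\<lambda>t. norm (f (Complex \<sigma> t))) \<in> O(\<lambda>t. t powr (e + d * (1 / 2 - \<sigma>)))"
proof -
  note fe_bigo[of \<sigma>]
  also have "(\<lambda>t. t powr (d * (1 / 2 - \<sigma>)) * norm (f (Complex (1 - \<sigma>) t))) \<in>
      O(\<lambda>t. t powr (d * (1 / 2 - \<sigma>)) * t powr e)"
    by (intro landau_o.big.mult assms) auto
  also have "(\<lambda>t. t powr (d * (1 / 2 - \<sigma>)) * t powr e) = (\<lambda>t. t powr (e + d * (1 / 2 - \<sigma>)))"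
    by (simp add: powr_add mult.commute)
  finally show ?thesis .
qed

lemma admissible_reflect:
  assumes "admissible (1 - \<sigma>) e" "e + d * (1 / 2 - \<sigma>) \<ge> 0"
  shows "admissible \<sigma> (e + d * (1 / 2 - \<sigma>))"
proof -
  have "e \<ge> 0" using assms(1) by (simp add: admissible_def)
  thus ?thesis
    using assms fe_bigo_powr by (auto simp: admissible_iff_bigo)
qed

lemma admissible_strip:
  assumes "admissible a e1" "admissible b e2" "a < b"
  obtains B where "B > 0"
    "\<And>s. \<lbrakk>a \<le> Re s; Re s \<le> b; Im s \<ge> 1\<rbrakk> \<Longrightarrow>
       norm (f s) \<le> B * Im s powr (e1 + (e2 - e1) * (Re s - a) / (b - a))"
proof -
  obtain C1 where C1: "\<And>t. t \<ge> 1 \<Longrightarrow> norm (f (Complex a t)) \<le> C1 * t powr e1"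
    using assms(1) by (auto simp: admissible_def)
  obtain C2 where C2: "\<And>t. t \<ge> 1 \<Longrightarrow> norm (f (Complex b t)) \<le> C2 * t powr e2"
    using assms(2) by (auto simp: admissible_def)
  have left: "norm (f s) \<le> C1 * Im s powr e1" if "Re s = a" "Im s \<ge> 1" for s
    using C1[OF that(2)] that(1) by (auto simp: complex_surj)
  have right: "norm (f s) \<le> C2 * Im s powr e2" if "Re s = b" "Im s \<ge> 1" for s
    using C2[OF that(2)] that(1) by (auto simp: complex_surj)
  have e: "e1 \<ge> 0" "e2 \<ge> 0" using assms by (auto simp: admissible_def)
  show ?thesis
    using phragmen_lindelof_convexity[OF holomorphic growth left right assms(3) e] that by blast
qed

lemma admissible_convex:
  assumes "admissible a e1" "admissible b e2" "a < \<sigma>" "\<sigma> < b"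
  shows "admissible \<sigma> (e1 + (e2 - e1) * (\<sigma> - a) / (b - a))"
proof -
  obtain B where B: "\<And>s. \<lbrakk>a \<le> Re s; Re s \<le> b; Im s \<ge> 1\<rbrakk> \<Longrightarrow>
       norm (f s) \<le> B * Im s powr (e1 + (e2 - e1) * (Re s - a) / (b - a))"
    using admissible_strip[OF assms(1,2)] assms(3,4) by (metis order.strict_trans)
  have e: "e1 \<ge> 0" "e2 \<ge> 0" using assms by (auto simp: admissible_def)
  have "(e2 - e1) * (\<sigma> - a) / (b - a) \<ge> - e1"
  proof -
    have "(e2 - e1) * (\<sigma> - a) \<ge> - e1 * (\<sigma> - a)" using assms e by (intro mult_right_mono) auto
    moreover have "e1 * (\<sigma> - a) \<le> e1 * (b - a)" using assms e by (intro mult_left_mono) auto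
    ultimately have "(e2 - e1) * (\<sigma> - a) \<ge> - e1 * (b - a)" by linarith
    thus ?thesis using assms by (simp add: pos_le_divide_eq)
  qed
  moreover have "norm (f (Complex \<sigma> t)) \<le> B * t powr (e1 + (e2 - e1) * (\<sigma> - a) / (b - a))" if "t \<ge> 1" for t
    using B[of "Complex \<sigma> t"] that assms by simp
  ultimately show ?thesis unfolding admissible_def by auto
qed

text \<open>Ensures that the infimum in \<open>order_function\<close> is over a nonempty set.
  Reflection settles \<sigma> < 0, boundedness settles \<sigma> > 1, and convexity between -1 and 2
  the rest.\<close>

lemma ex_admissible: "\<exists>e. admissible \<sigma> e"
proof -
  have left: "admissible \<sigma> (d * (1 / 2 - \<sigma>))" if "\<sigma> < 0" for \<sigma>
    using admissible_reflect[of \<sigma> 0] admissible_right[of "1 - \<sigma>"] that d_pos by simp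
  consider "\<sigma> < 0" | "\<sigma> > 1" | "-1 < \<sigma>" "\<sigma> < 2" by linarith
  thus ?thesis
  proof cases
    case 1
    from left[OF this] show ?thesis by (rule exI)
  next
    case 2
    from admissible_right[OF this] show ?thesis by (rule exI)
  next
    case 3
    from left[of "-1"] admissible_right[of 2] have "admissible (-1) (d * (1 / 2 - (-1)))" "admissible 2 0"
      by auto
    from admissible_convex[OF this 3] show ?thesis by (rule exI)
  qed
qed

lemma order_function_less_imp_admissible:
  assumes "order_function f \<sigma> < e"
  shows "admissible \<sigma> e"
proof -
  have "{e. admissible \<sigma> e} \<noteq> {}" using ex_admissible by blast
  from cInf_lessD[OF this assms[unfolded order_function_eq]]
  obtain e' where "admissible \<sigma> e'" "e' < e" by auto
  thus ?thesis using admissible_mono by auto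
qed

lemma order_function_le:
  assumes "admissible \<sigma> e"
  shows "order_function f \<sigma> \<le> e"
  unfolding order_function_eq
  by (rule cInf_lower) (use assms in \<open>auto simp: admissible_def intro: bdd_belowI[of _ 0]\<close>)

lemma order_function_nonneg: "order_function f \<sigma> \<ge> 0"
  unfolding order_function_eq
  by (rule cInf_greatest) (use ex_admissible in \<open>auto simp: admissible_def\<close>)

lemma order_function_eq_0I:
  assumes "\<And>e. e > 0 \<Longrightarrow> admissible \<sigma> e"
  shows "order_function f \<sigma> = 0"
proof (rule antisym)
  show "order_function f \<sigma> \<le> 0"
    by (rule field_le_epsilon) (use order_function_le assms in auto)
qed (rule order_function_nonneg)

lemma order_function_right: "\<sigma> > 1 \<Longrightarrow> order_function f \<sigma> = 0"
  by (rule order_function_eq_0I) (use admissible_right admissible_mono[of \<sigma> 0] in auto)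

text \<open>Interpolating between exponent e at \<sigma> and exponent 0 at a point b to the right of
  \<sigma>' gives e (b - \<sigma>')/(b - \<sigma>), which is at most e.\<close>

lemma order_function_0_mono:
  assumes "order_function f \<sigma> = 0" "\<sigma> \<le> \<sigma>'"
  shows "order_function f \<sigma>' = 0"
proof (cases "\<sigma> = \<sigma>'")
  case False
  define b where "b = max 1 \<sigma>' + 1"
  have b: "admissible b 0" "\<sigma>' < b" by (auto simp: b_def intro!: admissible_right)
  show ?thesis
  proof (rule order_function_eq_0I)
    fix e :: real assume e: "e > 0"
    hence "admissible \<sigma> e" using order_function_less_imp_admissible assms by auto
    from admissible_convex[OF this b(1) _ b(2)]
    have "admissible \<sigma>' (e + (0 - e) * (\<sigma>' - \<sigma>) / (b - \<sigma>))" using assms False by auto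
    thus "admissible \<sigma>' e"
      by (rule admissible_mono) (use e assms b in \<open>simp add: divide_simps\<close>)
  qed
qed (use assms in auto)

lemma order_function_0_closed:
  assumes "\<And>\<delta>. \<delta> > 0 \<Longrightarrow> order_function f (\<sigma> + \<delta>) = 0"
  shows "order_function f \<sigma> = 0"
proof (rule order_function_eq_0I)
  fix e :: real assume e: "e > 0"
  obtain e0 where e0: "admissible (\<sigma> - 1) e0" using ex_admissible[of "\<sigma> - 1"] by (elim exE)
  have e0': "e0 \<ge> 0" using e0 by (simp add: admissible_def)
  \<comment> \<open>Interpolation between exponent \<open>e0\<close> at \<sigma> - 1 and exponent
    \<delta> at \<sigma> + \<delta> gives (e0 + 1) \<delta> / (1 + \<delta>) at \<sigma>. This
    choice makes it e / (1 + \<delta>).\<close>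
  define \<delta> where "\<delta> = e / (e0 + 1)"
  have "(e0 + 1) * \<delta> = e" using e0' by (simp add: \<delta>_def)
  hence "e0 * \<delta> + \<delta> = e" by (simp only: ring_distribs mult_1)
  moreover have "\<delta> > 0" using e e0' by (simp add: \<delta>_def)
  ultimately have \<delta>: "\<delta> > 0" "e0 * \<delta> + \<delta> = e" by auto
  have "admissible (\<sigma> + \<delta>) \<delta>"
    using assms[OF \<delta>(1)] \<delta>(1) by (intro order_function_less_imp_admissible) linarith
  from admissible_convex[OF e0 this, of \<sigma>] \<delta>(1)
  have "admissible \<sigma> (e0 + (\<delta> - e0) / (1 + \<delta>))" by (simp add: add.commute)
  moreover have "e0 + (\<delta> - e0) / (1 + \<delta>) = (e0 * \<delta> + \<delta>) / (1 + \<delta>)"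
    using \<delta>(1) by (simp add: add_divide_distrib[symmetric] field_simps)
  moreover have "e / (1 + \<delta>) \<le> e / 1"
    using \<delta>(1) e by (intro divide_left_mono) auto
  ultimately show "admissible \<sigma> e" using \<delta>(2) admissible_mono by auto
qed

text \<open>Cauchy's theorem for F(s) = f(s) N^s on the rectangle with real parts \<sigma> and b and
  heights T and 2T. The right side is at least |a| T / 2 because \<open>F\<close> stays near
  \<open>a\<close>; the horizontal sides are O(T^e), which is o(T). The left side must supply the
  rest, and it is at most N^\<sigma> times the integral of |f|. A primitive \<open>H\<close>
  expresses each side by its values at two corners.\<close>

lemma mean_value_lower_bound:
  assumes adm: "admissible \<sigma> e" and e: "e < 1"
  obtains c T0 where "c > 0" "T0 \<ge> 1"
    "\<And>T. T \<ge> T0 \<Longrightarrow> integral {T..2*T} (\<lambda>t. norm (f (Complex \<sigma> t))) \<ge> c * T"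
proof -
  from leading_term obtain N :: nat and a \<sigma>0 where "N \<ge> 1 \<and> a \<noteq> 0 \<and> \<sigma>0 > 1 \<and>
      (\<forall>s. Re s \<ge> \<sigma>0 \<longrightarrow> norm (f s * of_nat N powr s - a) \<le> norm a / 2)"
    by (elim exE)
  hence N: "N \<ge> 1" and a: "a \<noteq> 0" and "\<sigma>0 > 1"
    and lead: "\<And>s. Re s \<ge> \<sigma>0 \<Longrightarrow> norm (f s * of_nat N powr s - a) \<le> norm a / 2"
    by simp_all
  define b where "b = max \<sigma>0 (\<sigma> + 1)"
  have b: "b \<ge> \<sigma>0" "b > 1" "\<sigma> < b" using \<open>\<sigma>0 > 1\<close> by (auto simp: b_def)
  have e0: "e \<ge> 0" using adm by (simp add: admissible_def)
  obtain B where B: "B > 0" "\<And>s. \<lbrakk>\<sigma> \<le> Re s; Re s \<le> b; Im s \<ge> 1\<rbrakk> \<Longrightarrow>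
       norm (f s) \<le> B * Im s powr (e + (0 - e) * (Re s - \<sigma>) / (b - \<sigma>))"
    using admissible_strip[OF adm admissible_right[OF b(2)] b(3)] by metis
  have f_le: "norm (f s) \<le> B * Im s powr e" if "\<sigma> \<le> Re s" "Re s \<le> b" "Im s \<ge> 1" for s
  proof -
    have "(0 - e) * (Re s - \<sigma>) / (b - \<sigma>) \<le> 0"
      using that e0 b by (intro divide_nonpos_pos) auto
    hence "B * Im s powr (e + (0 - e) * (Re s - \<sigma>) / (b - \<sigma>)) \<le> B * Im s powr e"
      using B(1) that by (intro mult_left_mono powr_mono) auto
    thus ?thesis using B(2)[OF that] by linarith
  qed
  define F where "F s = f s * of_nat N powr s" for s
  have norm_F: "norm (F s) = norm (f s) * real N powr Re s" for s
    using N by (simp add: F_def norm_mult norm_powr_real_powr)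
  have "F holomorphic_on {s. Im s > 0}"
    unfolding F_def using N by (intro holomorphic_intros holomorphic) auto
  then obtain H where H: "\<And>s. Im s > 0 \<Longrightarrow> (H has_field_derivative F s) (at s)"
    using holomorphic_convex_primitive'[OF convex_halfspace_Im_gt open_halfspace_Im_gt]
      at_within_open[OF _ open_halfspace_Im_gt] by (metis mem_Collect_eq)
  define D where "D = B * real N powr b * 2 powr e * (b - \<sigma>)"
  have horizontal: "norm (H (Complex b t) - H (Complex \<sigma> t)) \<le> D * T powr e"
    if t: "t \<in> {T, 2 * T}" and T: "T \<ge> 1" for t T
  proof -
    have "norm (H (Complex b t) - H (Complex \<sigma> t)) \<le> (B * real N powr b * (2 * T) powr e) * norm (Complex b t - Complex \<sigma> t)"
    proof (rule field_differentiable_bound[of "closed_segment (Complex \<sigma> t) (Complex b t)"])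
      fix z assume "z \<in> closed_segment (Complex \<sigma> t) (Complex b t)"
      hence z: "Re z \<in> {\<sigma>..b}" "Im z = t"
        using b by (auto simp: closed_segment_same_Im closed_segment_eq_real_ivl)
      show "(H has_field_derivative F z) (at z within closed_segment (Complex \<sigma> t) (Complex b t))"
        using H[of z] z t T by (auto intro: has_field_derivative_at_within)
      have "norm (f z) \<le> B * t powr e" using f_le[of z] z t T by auto
      also have "\<dots> \<le> B * (2 * T) powr e" using B t T e0 by (intro mult_left_mono powr_mono2) auto
      finally have "norm (f z) * real N powr Re z \<le> (B * (2 * T) powr e) * real N powr b"
        using z N B by (intro mult_mono powr_mono) auto
      thus "norm (F z) \<le> B * real N powr b * (2 * T) powr e" by (simp add: norm_F mult_ac)
    qed auto
    also have "Complex b t - Complex \<sigma> t = of_real (b - \<sigma>)" by (simp add: complex_eq_iff)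
    also have "norm (of_real (b - \<sigma>) :: complex) = b - \<sigma>" using b by (simp only: norm_of_real)
    finally show ?thesis using T by (simp add: D_def powr_mult mult_ac)
  qed
  have right: "norm (H (Complex b (2 * T)) - H (Complex b T)) \<ge> norm a * T / 2" if T: "T \<ge> 1" for T
  proof -
    define L where "L = closed_segment (Complex b T) (Complex b (2 * T))"
    \<comment> \<open>Subtracting a z from \<open>H\<close> leaves the derivative F - a, of norm at
      most |a|/2 on the right side.\<close>
    have "norm ((H (Complex b (2 * T)) - a * Complex b (2 * T)) - (H (Complex b T) - a * Complex b T))
        \<le> norm a / 2 * norm (Complex b (2 * T) - Complex b T)"
    proof (rule field_differentiable_bound[of L])
      fix z assume "z \<in> L"
      hence z: "Re z = b" "Im z \<ge> T"
        using T by (auto simp: L_def closed_segment_same_Re closed_segment_eq_real_ivl)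
      have "((\<lambda>z. H z - a * z) has_field_derivative (F z - a)) (at z)"
        using z T by (auto intro!: derivative_eq_intros H)
      thus "((\<lambda>z. H z - a * z) has_field_derivative (F z - a)) (at z within L)"
        by (rule has_field_derivative_at_within)
      show "norm (F z - a) \<le> norm a / 2" using lead[of z] z b by (simp add: F_def)
    qed (auto simp: L_def)
    also have "Complex b (2 * T) - Complex b T = \<i> * of_real T" by (simp add: complex_eq_iff)
    also have "norm (\<i> * of_real T) = T" using T by (simp add: norm_mult)
    finally have "norm ((H (Complex b (2 * T)) - H (Complex b T)) - a * (\<i> * of_real T)) \<le> norm a * T / 2"
      by (simp add: Complex_eq algebra_simps)
    moreover have "norm (a * (\<i> * of_real T)) = norm a * T" using T by (simp add: norm_mult)
    ultimately show ?thesis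
      using norm_triangle_ineq3[of "H (Complex b (2 * T)) - H (Complex b T)" "a * (\<i> * of_real T)"] by linarith
  qed
  have left: "norm (H (Complex \<sigma> (2 * T)) - H (Complex \<sigma> T)) \<le> real N powr \<sigma> * integral {T..2*T} (\<lambda>t. norm (f (Complex \<sigma> t)))"
    if T: "T \<ge> 1" for T
  proof -
    have deriv: "((\<lambda>t. H (Complex \<sigma> t)) has_vector_derivative \<i> * F (Complex \<sigma> t)) (at t within {T..2*T})"
      if "t \<in> {T..2*T}" for t
    proof -
      have "((\<lambda>u. Complex \<sigma> u) has_vector_derivative \<i>) (at t)"
        unfolding Complex_eq by (auto intro!: derivative_eq_intros)
      from field_vector_diff_chain_at[OF this H[of "Complex \<sigma> t"]] that T
      have "((\<lambda>t. H (Complex \<sigma> t)) has_vector_derivative \<i> * F (Complex \<sigma> t)) (at t)"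
        by (simp add: o_def)
      thus ?thesis by (rule has_vector_derivative_at_within)
    qed
    have hi: "((\<lambda>t. \<i> * F (Complex \<sigma> t)) has_integral (H (Complex \<sigma> (2 * T)) - H (Complex \<sigma> T))) {T..2*T}"
      using T by (intro fundamental_theorem_of_calculus deriv) auto
    have "norm (integral {T..2*T} (\<lambda>t. \<i> * F (Complex \<sigma> t))) \<le>
        integral {T..2*T} (\<lambda>t. real N powr \<sigma> * norm (f (Complex \<sigma> t)))"
    proof (rule integral_norm_bound_integral)
      show "(\<lambda>t. real N powr \<sigma> * norm (f (Complex \<sigma> t))) integrable_on {T..2*T}"
        using T by (intro integrable_continuous_interval continuous_intros continuous_on_vertical_line) auto
    qed (use hi in \<open>auto simp: norm_mult norm_F mult_ac\<close>)
    thus ?thesis using integral_unique[OF hi] by simp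
  qed
  \<comment> \<open>Half of the lower bound |a| T / 2 is spent on the two horizontal sides; the
    remaining |a| T / 4 is divided by the factor N^\<sigma> of the left side.\<close>
  define c where "c = norm a / 4 / real N powr \<sigma>"
  have "filterlim (\<lambda>T. norm a / 4 * T - 2 * D * T powr e) at_top at_top"
    using a e by real_asymp
  hence "eventually (\<lambda>T. norm a / 4 * T - 2 * D * T powr e \<ge> 0) at_top"
    by (rule filterlim_at_top[THEN iffD1, THEN spec])
  hence "eventually (\<lambda>T. norm a / 4 * T - 2 * D * T powr e \<ge> 0 \<and> T \<ge> 1) at_top"
    using eventually_ge_at_top[of 1] by eventually_elim auto
  then obtain T0 where T0: "\<And>T. T \<ge> T0 \<Longrightarrow> norm a / 4 * T - 2 * D * T powr e \<ge> 0 \<and> T \<ge> 1"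
    by (auto simp: eventually_at_top_linorder)
  show ?thesis
  proof (rule that[of c T0])
    show "c > 0" using a N by (simp add: c_def)
    show "T0 \<ge> 1" using T0[of T0] by simp
    fix T assume "T \<ge> T0"
    hence T: "norm a / 4 * T - 2 * D * T powr e \<ge> 0" "T \<ge> 1" using T0 by auto
    define p1 p2 p3 p4 where "p1 = H (Complex \<sigma> T)" "p2 = H (Complex b T)"
      "p3 = H (Complex b (2 * T))" "p4 = H (Complex \<sigma> (2 * T))"
    have "norm (p3 - p2) \<le> norm (p4 - p1) + norm (p3 - p4) + norm (p2 - p1)"
      using norm_triangle_ineq[of "p4 - p1" "p3 - p4"] norm_triangle_ineq4[of "p4 - p1 + (p3 - p4)" "p2 - p1"]
      by simp
    hence "norm a * T / 2 \<le> real N powr \<sigma> * integral {T..2*T} (\<lambda>t. norm (f (Complex \<sigma> t))) + D * T powr e + D * T powr e"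
      using right[OF T(2)] left[OF T(2)] horizontal[OF _ T(2), of T] horizontal[OF _ T(2), of "2 * T"]
      unfolding p1_p2_p3_p4_def by auto
    hence "norm a / 4 * T \<le> real N powr \<sigma> * integral {T..2*T} (\<lambda>t. norm (f (Complex \<sigma> t)))"
      using T(1) by simp
    thus "integral {T..2*T} (\<lambda>t. norm (f (Complex \<sigma> t))) \<ge> c * T"
      using N by (simp add: c_def field_simps)
  qed
qed

text \<open>
  If the order vanished left of the critical line, the functional equation would make \<open>f\<close> decay
  on the reflected line, against the mean value bound.
\<close>

lemma order_function_pos:
  assumes "\<sigma> < 1 / 2"
  shows "order_function f \<sigma> > 0"
proof (rule ccontr)
  assume "\<not> order_function f \<sigma> > 0"
  hence 0: "order_function f \<sigma> \<le> 0" by simp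
  \<comment> \<open>Half the exponent gained by reflection: an order at most 0 at \<sigma> makes e
    admissible there, and reflection turns it into e - 2e = -e at 1 - \<sigma>.\<close>
  define e where "e = d * (1 / 2 - \<sigma>) / 2"
  have e: "e > 0" using assms d_pos by (simp add: e_def)
  have "admissible (1 - (1 - \<sigma>)) e" using order_function_less_imp_admissible[of \<sigma> e] 0 e by simp
  hence "(\<lambda>t. norm (f (Complex (1 - \<sigma>) t))) \<in> O(\<lambda>t. t powr (e + d * (1 / 2 - (1 - \<sigma>))))"
    using e by (intro fe_bigo_powr) (auto simp: admissible_iff_bigo)
  also have "e + d * (1 / 2 - (1 - \<sigma>)) = - e" by (simp add: e_def field_simps)
  finally have decay: "(\<lambda>t. norm (f (Complex (1 - \<sigma>) t))) \<in> O(\<lambda>t. t powr (- e))" .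
  also have "(\<lambda>t::real. t powr (- e)) \<in> O(\<lambda>t. t powr 0)" using e by real_asymp
  finally have "admissible (1 - \<sigma>) 0" by (simp add: admissible_iff_bigo)
  then obtain c T0 where c: "c > 0" "T0 \<ge> 1"
    "\<And>T. T \<ge> T0 \<Longrightarrow> integral {T..2*T} (\<lambda>t. norm (f (Complex (1 - \<sigma>) t))) \<ge> c * T"
    by (rule mean_value_lower_bound) auto
  from decay obtain K where K: "K > 0" "eventually (\<lambda>t. norm (norm (f (Complex (1 - \<sigma>) t))) \<le> K * norm (t powr (- e))) at_top"
    by (elim landau_o.bigE)
  then obtain T1 where T1: "\<And>t. t \<ge> T1 \<Longrightarrow> norm (f (Complex (1 - \<sigma>) t)) \<le> K * t powr (- e)"
    by (auto simp: eventually_at_top_linorder)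
  have "((\<lambda>T. K * T powr (- e)) \<longlongrightarrow> 0) at_top" using e by real_asymp
  hence "eventually (\<lambda>T. K * T powr (- e) < c) at_top" by (rule order_tendstoD) (rule c)
  hence "eventually (\<lambda>T. K * T powr (- e) < c \<and> T \<ge> max T0 T1) at_top"
    using eventually_ge_at_top[of "max T0 T1"] by eventually_elim auto
  then obtain T where T: "K * T powr (- e) < c" "T \<ge> T0" "T \<ge> T1"
    by (auto simp: eventually_at_top_linorder)
  have "c * T \<le> integral {T..2*T} (\<lambda>t. norm (f (Complex (1 - \<sigma>) t)))" using c T by blast
  also have "\<dots> \<le> integral {T..2*T} (\<lambda>t. K * T powr (- e))"
  proof (rule integral_le)
    show "(\<lambda>t. norm (f (Complex (1 - \<sigma>) t))) integrable_on {T..2*T}"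
      using T c by (intro integrable_continuous_interval continuous_intros continuous_on_vertical_line) auto
    fix t assume t: "t \<in> {T..2*T}"
    have "norm (f (Complex (1 - \<sigma>) t)) \<le> K * t powr (- e)" using T1[of t] t T by simp
    also have "\<dots> \<le> K * T powr (- e)" using K t T c e by (intro mult_left_mono powr_mono2') auto
    finally show "norm (f (Complex (1 - \<sigma>) t)) \<le> K * T powr (- e)" .
  qed auto
  also have "\<dots> = K * T powr (- e) * T" using T c by simp
  also have "\<dots> < c * T" using T c by (intro mult_strict_right_mono) auto
  finally show False by simp
qed

text \<open>\<open>order_abscissa\<close> is a definite description, so existence and uniqueness
  must be shown first. The witness is the infimum of the zero set of the order function: 1/2 bounds
  this set below, it contains 1, and it is closed upwards and under limits from the right.\<close>

lemma order_abscissa_properties: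
  shows "order_abscissa f \<le> 1" "order_abscissa f \<ge> 1 / 2"
    "\<And>\<sigma>. \<sigma> < order_abscissa f \<Longrightarrow> order_function f \<sigma> > 0"
    "\<And>\<sigma>. \<sigma> \<ge> order_abscissa f \<Longrightarrow> order_function f \<sigma> = 0"
proof -
  define P where "P b \<longleftrightarrow> b \<le> 1 \<and> (\<forall>\<sigma><b. order_function f \<sigma> > 0) \<and> (\<forall>\<sigma>\<ge>b. order_function f \<sigma> = 0)" for b
  define Z where "Z = {\<sigma>. order_function f \<sigma> = 0}"
  have Z1: "1 \<in> Z" unfolding Z_def using order_function_0_closed[of 1] order_function_right by auto
  have Z_lower: "1 / 2 \<le> \<sigma>" if "\<sigma> \<in> Z" for \<sigma>
    using order_function_pos[of \<sigma>] that by (cases "\<sigma> < 1 / 2") (auto simp: Z_def)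
  hence bdd: "bdd_below Z" by (rule bdd_belowI)
  have P_Inf: "P (Inf Z)" unfolding P_def
  proof (intro conjI allI impI)
    show "Inf Z \<le> 1" using Z1 bdd by (rule cInf_lower)
    fix \<sigma>
    show "order_function f \<sigma> > 0" if "\<sigma> < Inf Z"
    proof -
      have "\<sigma> \<notin> Z" using that cInf_lower[OF _ bdd, of \<sigma>] by auto
      thus ?thesis using order_function_nonneg[of \<sigma>] by (auto simp: Z_def)
    qed
    show "order_function f \<sigma> = 0" if "\<sigma> \<ge> Inf Z"
    proof (rule order_function_0_closed)
      fix \<delta> :: real assume "\<delta> > 0"
      hence "Inf Z < \<sigma> + \<delta>" using that by simp
      then obtain z where "z \<in> Z" "z < \<sigma> + \<delta>" using cInf_lessD[of Z] Z1 by auto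
      thus "order_function f (\<sigma> + \<delta>) = 0" using order_function_0_mono[of z "\<sigma> + \<delta>"] by (auto simp: Z_def)
    qed
  qed
  have unique: "\<not> b < b'" if "P b" "P b'" for b b'
    using that unfolding P_def by force
  have "b = Inf Z" if "P b" for b
    using unique[OF that P_Inf] unique[OF P_Inf that] by simp
  hence "P (THE b. P b)" by (rule theI[of P, OF P_Inf])
  moreover have "(THE b. P b) = order_abscissa f" by (simp add: P_def order_abscissa_def)
  ultimately have *: "P (order_abscissa f)" by simp
  show "order_abscissa f \<le> 1"
    "\<And>\<sigma>. \<sigma> < order_abscissa f \<Longrightarrow> order_function f \<sigma> > 0"
    "\<And>\<sigma>. \<sigma> \<ge> order_abscissa f \<Longrightarrow> order_function f \<sigma> = 0"
    using * by (auto simp: P_def)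
  from this(3)[of "order_abscissa f"] show "order_abscissa f \<ge> 1 / 2"
    by (intro Z_lower) (simp add: Z_def)
qed

end

subsection \<open>Moments on vertical lines\<close>

text \<open>Linearising \<open>x powr p\<close> at 1 bounds a \<open>p\<close>-th moment below by a first moment without Hoelder's inequality.\<close>

lemma real_powr_ge_tangent:
  fixes x p :: real
  assumes "x \<ge> 0" "p \<ge> 1"
  shows "x powr p \<ge> 1 + p * (x - 1)"
proof (cases "x = 0")
  case False
  hence "1 + (x - 1) > 0" "x > 0" using assms by auto
  have "convex_on {0<..} (\<lambda>x. x powr p)"
    by (rule convex_on_realI[where f' = "\<lambda>x. p * x powr (p - 1)"])
       (use assms in \<open>auto intro!: derivative_eq_intros mult_left_mono powr_mono2\<close>)
  moreover have "((\<lambda>x. x powr p) has_real_derivative p) (at 1 within {0<..})"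
    by (rule has_field_derivative_at_within) (auto intro!: derivative_eq_intros)
  ultimately have "x powr p - 1 powr p \<ge> p * (x - 1)"
    using \<open>x > 0\<close> by (intro convex_on_imp_above_tangent[of "{0<..}"]) (auto simp: interior_open)
  thus ?thesis by simp
qed (use assms in auto)

lemma set_nn_integral_powr_finite:
  fixes e K :: real
  assumes "e < -1" "K \<ge> 0"
  shows "(\<integral>\<^sup>+t\<in>{1..}. ennreal (K * t powr e) \<partial>lborel) < \<infinity>"
proof -
  have "((\<lambda>t. K * t powr e) has_integral K * (- (1 powr (e + 1)) / (e + 1))) {1..}"
    using has_integral_powr_to_inf[OF assms(1), of 1] by (intro has_integral_mult_right) simp
  from nn_integral_has_integral_lebesgue[OF _ this] assms
  have "(\<integral>\<^sup>+t. ennreal (indicator {1..} t * (K * t powr e)) \<partial>lborel) < \<infinity>" by auto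
  also have "(\<lambda>t. ennreal (indicator {1..} t * (K * t powr e))) = (\<lambda>t. ennreal (K * t powr e) * indicator {1..} t)"
    by (auto simp: indicator_def)
  finally show ?thesis .
qed

lemma set_nn_integral_infinite_of_blocks:
  fixes g :: "real \<Rightarrow> real"
  assumes cont: "continuous_on {1..} g" and nonneg: "\<And>t. t \<ge> 1 \<Longrightarrow> g t \<ge> 0"
    and \<kappa>: "\<kappa> > 0" and T0: "T0 \<ge> 1"
    and block: "\<And>T. T \<ge> T0 \<Longrightarrow> integral {T..2*T} g \<ge> \<kappa>"
  shows "(\<integral>\<^sup>+t\<in>{1..}. ennreal (g t) \<partial>lborel) = \<infinity>"
proof -
  define h where "h t = ennreal (indicator {1..} t * g t)" for t
  have meas: "h \<in> borel_measurable lborel"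
  proof -
    have "(\<lambda>t. indicator {1..} t * g t) \<in> borel_measurable lborel"
      using borel_measurable_continuous_on_indicator[OF _ cont] by simp
    thus ?thesis unfolding h_def by (rule measurable_compose[OF _ measurable_ennreal])
  qed
  have block': "(\<integral>\<^sup>+t\<in>{T..2*T}. h t \<partial>lborel) \<ge> ennreal \<kappa>" if T: "T \<ge> T0" for T
  proof -
    have "(g has_integral integral {T..2*T} g) {T..2*T}"
      using T T0 by (intro integrable_integral integrable_continuous_interval continuous_on_subset[OF cont]) auto
    from nn_integral_has_integral_lebesgue[OF _ this] nonneg T T0
    have "(\<integral>\<^sup>+t. ennreal (indicator {T..2*T} t * g t) \<partial>lborel) = ennreal (integral {T..2*T} g)" by auto
    also have "(\<lambda>t. ennreal (indicator {T..2*T} t * g t)) = (\<lambda>t. h t * indicator {T..2*T} t)"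
      using T T0 by (auto simp: indicator_def h_def)
    finally show ?thesis using block[OF T] by (simp add: ennreal_leI)
  qed
  \<comment> \<open>The ratio 3 rather than 2 places the closed block [T, 2T] inside [1, 3T) and
    keeps it disjoint from [1, T), so each step of the induction adds a full \<kappa>.\<close>
  have "(\<integral>\<^sup>+t\<in>{1..<T0 * 3 ^ J}. h t \<partial>lborel) \<ge> of_nat J * ennreal \<kappa>" for J
  proof (induction J)
    case (Suc J)
    define T where "T = T0 * 3 ^ J"
    have T: "T \<ge> T0" using T0 by (simp add: T_def mult_le_cancel_left1)
    have "of_nat (Suc J) * ennreal \<kappa> = of_nat J * ennreal \<kappa> + ennreal \<kappa>"
      by (simp add: algebra_simps)
    also have "\<dots> \<le> (\<integral>\<^sup>+t\<in>{1..<T}. h t \<partial>lborel) + (\<integral>\<^sup>+t\<in>{T..2*T}. h t \<partial>lborel)"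
      using Suc.IH block'[OF T] by (intro add_mono) (auto simp: T_def)
    also have "\<dots> = (\<integral>\<^sup>+t\<in>{1..<T} \<union> {T..2*T}. h t \<partial>lborel)"
      using meas by (intro nn_integral_disjoint_pair[symmetric]) auto
    also have "\<dots> \<le> (\<integral>\<^sup>+t\<in>{1..<T0 * 3 ^ Suc J}. h t \<partial>lborel)"
    proof -
      have "T0 * 3 ^ Suc J = 3 * T" by (simp add: T_def)
      thus ?thesis using T T0 by (intro nn_integral_mono mult_left_mono) (auto simp: indicator_def)
    qed
    finally show ?case .
  qed simp
  moreover have "(\<integral>\<^sup>+t\<in>A. h t \<partial>lborel) \<le> (\<integral>\<^sup>+t\<in>{1..}. ennreal (g t) \<partial>lborel)" for A
    by (intro nn_integral_mono) (auto simp: indicator_def h_def)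
  ultimately have large: "of_nat J * ennreal \<kappa> \<le> (\<integral>\<^sup>+t\<in>{1..}. ennreal (g t) \<partial>lborel)" for J
    using order.trans by blast
  show ?thesis
  proof (cases "\<integral>\<^sup>+t\<in>{1..}. ennreal (g t) \<partial>lborel")
    case (real r)
    obtain J where "r < real J * \<kappa>" using reals_Archimedean3[OF \<kappa>] by blast
    moreover have "ennreal (real J * \<kappa>) \<le> ennreal r"
      using large[of J] real \<kappa> by (simp add: ennreal_mult ennreal_of_nat_eq_real_of_nat)
    ultimately show ?thesis using real by (simp add: ennreal_le_iff)
  qed auto
qed

context strip_function
begin

lemma Lp_integral_finite:
  assumes adm: "admissible \<sigma> e" and p: "p \<ge> 0" "p * e - \<alpha> < -1"
  shows "(\<integral>\<^sup>+t\<in>{1..}. ennreal (norm (f (Complex \<sigma> t)) powr p / t powr \<alpha>) \<partial>lborel) < \<infinity>"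
proof -
  obtain K where K: "\<And>t. t \<ge> 1 \<Longrightarrow> norm (f (Complex \<sigma> t)) \<le> K * t powr e"
    using adm by (auto simp: admissible_def)
  have "norm (f (Complex \<sigma> t)) powr p / t powr \<alpha> \<le> \<bar>K\<bar> powr p * t powr (p * e - \<alpha>)" if t: "t \<ge> 1" for t
  proof -
    have "norm (f (Complex \<sigma> t)) \<le> \<bar>K\<bar> * t powr e"
      by (rule order.trans[OF K[OF t]]) (intro mult_right_mono, auto)
    hence "norm (f (Complex \<sigma> t)) powr p \<le> (\<bar>K\<bar> * t powr e) powr p"
      using p by (intro powr_mono2) auto
    hence "norm (f (Complex \<sigma> t)) powr p / t powr \<alpha> \<le> (\<bar>K\<bar> * t powr e) powr p / t powr \<alpha>"
      by (rule divide_right_mono) simp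
    also have "\<dots> = \<bar>K\<bar> powr p * t powr (p * e - \<alpha>)"
      by (simp add: powr_mult powr_powr powr_diff mult.commute)
    finally show ?thesis .
  qed
  hence "(\<integral>\<^sup>+t\<in>{1..}. ennreal (norm (f (Complex \<sigma> t)) powr p / t powr \<alpha>) \<partial>lborel) \<le>
      (\<integral>\<^sup>+t\<in>{1..}. ennreal (\<bar>K\<bar> powr p * t powr (p * e - \<alpha>)) \<partial>lborel)"
    by (intro nn_integral_mono) (auto simp: indicator_def intro!: ennreal_leI)
  also have "\<dots> < \<infinity>" by (rule set_nn_integral_powr_finite) (use p in auto)
  finally show ?thesis .
qed

text \<open>The functional equation at 1 - \<sigma> bounds |f| on the line \<sigma> below by t^D
  times |f| on the reflected line. Hence the integrand is at least a multiple of t^\<beta> x(t)^p,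
  where x has mean at least 1 on [T, 2T]. The tangent inequality makes each block at least a
  multiple of T^(\<beta> + 1), which stays bounded below even in the limiting case \<beta> =
  -1.\<close>

lemma Lp_integral_infinite:
  assumes adm: "admissible (1 - \<sigma>) e" "e < 1" and p: "p \<ge> 1" "p * (d * (1 / 2 - \<sigma>)) - \<alpha> \<ge> -1"
  shows "(\<integral>\<^sup>+t\<in>{1..}. ennreal (norm (f (Complex \<sigma> t)) powr p / t powr \<alpha>) \<partial>lborel) = \<infinity>"
proof -
  define D where "D = d * (1 / 2 - \<sigma>)"
  define \<beta> where "\<beta> = p * D - \<alpha>"
  have \<beta>: "\<beta> \<ge> -1" using p by (simp add: \<beta>_def D_def)
  obtain c T0 where c: "c > 0" "T0 \<ge> 1"
    and mean: "\<And>T. T \<ge> T0 \<Longrightarrow> integral {T..2*T} (\<lambda>t. norm (f (Complex (1 - \<sigma>) t))) \<ge> c * T"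
    using mean_value_lower_bound[OF adm] by blast
  have "d * (1 / 2 - (1 - \<sigma>)) = - D" by (simp add: D_def algebra_simps)
  hence "(\<lambda>t. norm (f (Complex (1 - \<sigma>) t))) \<in> O(\<lambda>t. t powr (- D) * norm (f (Complex \<sigma> t)))"
    using fe_bigo[of "1 - \<sigma>"] by simp
  then obtain K where K: "K > 0" "eventually (\<lambda>t. norm (norm (f (Complex (1 - \<sigma>) t))) \<le>
      K * norm (t powr (- D) * norm (f (Complex \<sigma> t)))) at_top"
    by (elim landau_o.bigE)
  then obtain T1 where T1: "\<And>t. t \<ge> T1 \<Longrightarrow> norm (f (Complex (1 - \<sigma>) t)) \<le> K * (t powr (- D) * norm (f (Complex \<sigma> t)))"
    by (auto simp: eventually_at_top_linorder norm_mult)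
  define g where "g t = norm (f (Complex \<sigma> t)) powr p / t powr \<alpha>" for t
  define x where "x t = norm (f (Complex (1 - \<sigma>) t)) / c" for t
  \<comment> \<open>Guarantees m T^\<beta> \<le> t^\<beta> on [T, 2T] for either sign of
    \<beta>.\<close>
  define m where "m = min 1 (2 powr \<beta>)"
  define M where "M = (c / K) powr p"
  have m: "m > 0" by (simp add: m_def)
  have M: "M > 0" using c K by (simp add: M_def)
  have g_lower: "g t \<ge> M * m * T powr \<beta> * (1 + p * (x t - 1))"
    if t: "t \<in> {T..2*T}" and T: "T \<ge> max T0 T1" for t T
  proof -
    have t1: "t \<ge> 1" "t \<ge> T1" "T \<ge> 1" "T \<le> t" "t \<le> 2 * T" using t T c by auto
    have "c * x t \<le> K * (t powr (- D) * norm (f (Complex \<sigma> t)))"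
      using T1[OF t1(2)] c by (simp add: x_def)
    hence "(c / K) * (t powr D * x t) \<le> norm (f (Complex \<sigma> t))"
      using K t1 by (simp add: powr_minus field_simps)
    hence "((c / K) * (t powr D * x t)) powr p \<le> norm (f (Complex \<sigma> t)) powr p"
      using c K p by (intro powr_mono2) (auto simp: x_def)
    hence "((c / K) * (t powr D * x t)) powr p / t powr \<alpha> \<le> g t"
      unfolding g_def by (rule divide_right_mono) simp
    also have "((c / K) * (t powr D * x t)) powr p / t powr \<alpha> = M * t powr \<beta> * x t powr p"
    proof -
      have "(q * (t powr D * w)) powr p / t powr \<alpha> = q powr p * t powr (p * D - \<alpha>) * w powr p"
        if "q \<ge> 0" "w \<ge> 0" for q w
        using that by (simp add: powr_mult powr_powr powr_diff mult_ac)
      moreover have "c / K \<ge> 0" "x t \<ge> 0" using c K by (auto simp: x_def)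
      ultimately show ?thesis by (simp only: M_def \<beta>_def)
    qed
    finally have 1: "M * t powr \<beta> * x t powr p \<le> g t" .
    have "m * T powr \<beta> \<le> t powr \<beta>"
    proof (cases "\<beta> \<ge> 0")
      case True
      have "m * T powr \<beta> \<le> 1 * T powr \<beta>" by (intro mult_right_mono) (auto simp: m_def)
      also have "\<dots> \<le> t powr \<beta>" using True t1 by (simp add: powr_mono2)
      finally show ?thesis .
    next
      case False
      have "m * T powr \<beta> \<le> 2 powr \<beta> * T powr \<beta>" by (intro mult_right_mono) (auto simp: m_def)
      also have "\<dots> = (2 * T) powr \<beta>" using t1 by (simp add: powr_mult)
      also have "\<dots> \<le> t powr \<beta>" using False t1 by (intro powr_mono2') auto
      finally show ?thesis .
    qed
    hence "M * (m * T powr \<beta>) * x t powr p \<le> M * t powr \<beta> * x t powr p"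
      using M by (intro mult_right_mono mult_left_mono) auto
    moreover have "M * (m * T powr \<beta>) * (1 + p * (x t - 1)) \<le> M * (m * T powr \<beta>) * x t powr p"
      using M m p c by (intro mult_left_mono real_powr_ge_tangent) (auto simp: x_def)
    ultimately show ?thesis using 1 by (simp add: mult_ac)
  qed
  have "(\<integral>\<^sup>+t\<in>{1..}. ennreal (g t) \<partial>lborel) = \<infinity>"
  proof (rule set_nn_integral_infinite_of_blocks)
    show contg: "continuous_on {1..} g"
      unfolding g_def using p by (intro continuous_intros continuous_on_powr' continuous_on_vertical_line) auto
    show "g t \<ge> 0" for t by (simp add: g_def)
    show "M * m > 0" using M m by simp
    show "max T0 T1 \<ge> 1" using c by simp
    fix T assume T: "T \<ge> max T0 T1"
    have T': "T \<ge> 1" "T \<ge> T0" using T c by auto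
    define y where "y t = M * m * T powr \<beta> * (1 + p * (x t - 1))" for t
    have contf: "continuous_on {T..2*T} (\<lambda>t. norm (f (Complex (1 - \<sigma>) t)))"
      using T' by (intro continuous_intros continuous_on_vertical_line) auto
    hence int_f: "((\<lambda>t. norm (f (Complex (1 - \<sigma>) t))) has_integral integral {T..2*T} (\<lambda>t. norm (f (Complex (1 - \<sigma>) t)))) {T..2*T}"
      by (intro integrable_integral integrable_continuous_interval)
    define I where "I = integral {T..2*T} (\<lambda>t. norm (f (Complex (1 - \<sigma>) t)))"
    have I: "I \<ge> c * T" unfolding I_def using mean T' by blast
    have one: "((\<lambda>_. 1 :: real) has_integral T) {T..2*T}"
      using has_integral_const_real[of "1 :: real" T "2 * T"] T' by simp
    have "((\<lambda>t. M * m * T powr \<beta> * (1 + p * (norm (f (Complex (1 - \<sigma>) t)) / c - 1))) has_integral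
        M * m * T powr \<beta> * (T + p * (I / c - T))) {T..2*T}"
      by (intro has_integral_mult_right has_integral_add has_integral_diff has_integral_divide one
          int_f[folded I_def])
    hence int_y: "(y has_integral M * m * T powr \<beta> * (T + p * (I / c - T))) {T..2*T}"
      by (simp add: y_def[abs_def] x_def)
    have int_g: "(g has_integral integral {T..2*T} g) {T..2*T}"
      using T' by (intro integrable_integral integrable_continuous_interval continuous_on_subset[OF contg]) auto
    have "T powr (-1) * T \<le> T powr \<beta> * T" using T' \<beta> by (intro mult_right_mono powr_mono) auto
    moreover have "T powr (-1) * T = 1" using T' by (simp add: powr_minus)
    moreover have "I / c \<ge> T" using I c by (simp add: field_simps)
    ultimately have "M * m * 1 \<le> M * m * (T powr \<beta> * (T + p * (I / c - T)))"
      using M m p by (intro mult_left_mono order.trans[OF _ mult_left_mono[of T "T + p * (I / c - T)"]]) auto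
    also have "\<dots> = M * m * T powr \<beta> * (T + p * (I / c - T))" by (simp add: mult_ac)
    also have "\<dots> \<le> integral {T..2*T} g"
      by (rule has_integral_le[OF int_y int_g]) (use g_lower T in \<open>auto simp: y_def\<close>)
    finally show "integral {T..2*T} g \<ge> M * m" by simp
  qed
  thus ?thesis by (simp add: g_def)
qed

text \<open>
  A lower bound \<open>L\<close> is needed even for the upper estimate: the infimum of a set of reals that is
  unbounded below is a junk value.
\<close>

lemma Lp_abscissa_bounds:
  assumes k: "k \<ge> (1::nat)" and \<alpha>: "\<alpha> > 1"
    and lower: "\<And>\<sigma>. \<sigma> < L \<Longrightarrow> order_function f (1 - \<sigma>) < 1"
    and L: "L \<le> 1 / 2 - (\<alpha> - 1) / (2 * d * real k)"
    and fin: "order_function f \<sigma> < (\<alpha> - 1) / (2 * real k)" "\<sigma> \<le> 1"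
  shows "L \<le> Lp_abscissa f (2 * real k) \<alpha>" "Lp_abscissa f (2 * real k) \<alpha> \<le> \<sigma>"
proof -
  define S where "S = {\<sigma>. \<sigma> \<le> 1 \<and>
    (\<integral>\<^sup>+t\<in>{1..}. ennreal (norm (f (Complex \<sigma> t)) powr (2 * real k) / t powr \<alpha>) \<partial>lborel) < \<infinity>}"
  have S: "Lp_abscissa f (2 * real k) \<alpha> = Inf S" by (simp add: Lp_abscissa_def S_def)
  have inf: "L \<le> \<sigma>'" if "\<sigma>' \<in> S" for \<sigma>'
  proof (rule ccontr)
    assume "\<not> L \<le> \<sigma>'"
    hence \<sigma>': "\<sigma>' < L" by simp
    obtain e where e: "order_function f (1 - \<sigma>') < e" "e < 1" using dense[OF lower[OF \<sigma>']] by blast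
    \<comment> \<open>The assumed bound on \<open>L\<close> puts every \<sigma>' < L in the
      divergent range for p = 2k, so no such point can belong to \<open>S\<close>.\<close>
    have "(\<alpha> - 1) / (2 * d * real k) \<le> 1 / 2 - \<sigma>'" using \<sigma>' L by linarith
    hence "\<alpha> - 1 \<le> (1 / 2 - \<sigma>') * (2 * d * real k)"
      using d_pos k by (subst (asm) pos_divide_le_eq) auto
    hence "(\<integral>\<^sup>+t\<in>{1..}. ennreal (norm (f (Complex \<sigma>' t)) powr (2 * real k) / t powr \<alpha>) \<partial>lborel) = \<infinity>"
      using order_function_less_imp_admissible[OF e(1)] e(2) k
      by (intro Lp_integral_infinite) (auto simp: algebra_simps)
    thus False using that by (simp add: S_def)
  qed
  obtain e where e: "order_function f \<sigma> < e" "e < (\<alpha> - 1) / (2 * real k)" using dense[OF fin(1)] by blast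
  have "e * (2 * real k) < \<alpha> - 1" using e(2) k by (subst (asm) pos_less_divide_eq) auto
  hence "2 * real k * e - \<alpha> < -1" by (simp add: algebra_simps)
  from Lp_integral_finite[OF order_function_less_imp_admissible[OF e(1)] _ this] fin(2)
  have mem: "\<sigma> \<in> S" by (simp add: S_def)
  show "L \<le> Lp_abscissa f (2 * real k) \<alpha>" unfolding S
    by (rule cInf_greatest) (use mem inf in auto)
  show "Lp_abscissa f (2 * real k) \<alpha> \<le> \<sigma>" unfolding S
    by (rule cInf_lower[OF mem bdd_belowI]) (rule inf)
qed

text \<open>For \<sigma> < 1/2 the order vanishes at 1 - \<sigma>, so reflection gives order at most
  d(1/2 - \<sigma>). At \<open>\<sigma>0\<close> this bound equals the convergence threshold
  (\<alpha> - 1)/(2k), and \<open>\<sigma>0\<close> is also the largest \<open>L\<close> that the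
  divergence condition permits. Points just right of \<open>\<sigma>0\<close> therefore squeeze the
  abscissa.\<close>

lemma lindelof_imp_Lp_abscissa:
  assumes b: "order_abscissa f = 1 / 2" and k: "k \<ge> (1::nat)" and \<alpha>: "\<alpha> > 1" "real k \<ge> (\<alpha> - 1) / d"
  shows "Lp_abscissa f (2 * real k) \<alpha> = 1 / 2 * (1 - (\<alpha> - 1) / (d * real k))"
proof -
  define \<sigma>0 where "\<sigma>0 = 1 / 2 - (\<alpha> - 1) / (2 * d * real k)"
  have \<sigma>0: "\<sigma>0 < 1 / 2" using d_pos k \<alpha> by (simp add: \<sigma>0_def)
  have lower: "order_function f (1 - \<sigma>) < 1" if "\<sigma> < \<sigma>0" for \<sigma>
    using order_abscissa_properties(4)[of "1 - \<sigma>"] b that \<sigma>0 by simp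
  have ord: "order_function f \<sigma> \<le> d * (1 / 2 - \<sigma>)" if "\<sigma> < 1 / 2" for \<sigma>
  proof (rule field_le_epsilon)
    fix e :: real assume "e > 0"
    moreover have "order_function f (1 - \<sigma>) = 0"
      using that b by (intro order_abscissa_properties(4)) simp
    ultimately have "admissible \<sigma> (e + d * (1 / 2 - \<sigma>))"
      using that d_pos by (intro admissible_reflect order_function_less_imp_admissible) auto
    thus "order_function f \<sigma> \<le> d * (1 / 2 - \<sigma>) + e" using order_function_le by (simp add: add.commute)
  qed
  have fin: "order_function f \<sigma> < (\<alpha> - 1) / (2 * real k)" if "\<sigma>0 < \<sigma>" "\<sigma> < 1 / 2" for \<sigma>
  proof -
    have "order_function f \<sigma> \<le> d * (1 / 2 - \<sigma>)" by (rule ord[OF that(2)])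
    also have "\<dots> < d * (1 / 2 - \<sigma>0)" using that d_pos by simp
    also have "\<dots> = (\<alpha> - 1) / (2 * real k)" using d_pos by (simp add: \<sigma>0_def)
    finally show ?thesis .
  qed
  have bounds: "\<sigma>0 \<le> Lp_abscissa f (2 * real k) \<alpha>" "Lp_abscissa f (2 * real k) \<alpha> \<le> \<sigma>"
    if "\<sigma>0 < \<sigma>" "\<sigma> < 1 / 2" for \<sigma>
    using Lp_abscissa_bounds[OF k \<alpha>(1) lower _ fin[OF that]] that by (auto simp: \<sigma>0_def)
  have "Lp_abscissa f (2 * real k) \<alpha> \<le> \<sigma>0"
  proof (rule dense_ge_bounded[OF \<sigma>0])
    fix w assume "\<sigma>0 < w" "w < 1 / 2" thus "Lp_abscissa f (2 * real k) \<alpha> \<le> w" by (rule bounds)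
  qed
  moreover obtain w where "\<sigma>0 < w" "w < 1 / 2" using dense[OF \<sigma>0] by blast
  hence "\<sigma>0 \<le> Lp_abscissa f (2 * real k) \<alpha>" by (rule bounds(1))
  ultimately have "Lp_abscissa f (2 * real k) \<alpha> = \<sigma>0" by simp
  thus ?thesis using d_pos k by (simp add: \<sigma>0_def field_simps)
qed

lemma Lp_abscissa_imp_lindelof:
  assumes mu: "order_function f (1 / 2) < d / 4"
    and eq: "\<And>\<alpha>. \<lbrakk>\<alpha> > 1; 1 \<ge> (\<alpha> - 1) / d\<rbrakk> \<Longrightarrow>
      Lp_abscissa f 2 \<alpha> = order_abscissa f * (1 - (\<alpha> - 1) / d)"
  shows "order_abscissa f = 1 / 2"
proof (rule ccontr)
  define b where "b = order_abscissa f"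
  assume "order_abscissa f \<noteq> 1 / 2"
  hence b: "1 / 2 < b" "b \<le> 1" using order_abscissa_properties(1,2) by (auto simp: b_def)
  \<comment> \<open>Together with L = 0 in \<open>key\<close>, this makes the set defining the
    abscissa bounded below.\<close>
  have lower: "order_function f (1 - \<sigma>) < 1" if "\<sigma> < 0" for \<sigma>
    using order_function_right[of "1 - \<sigma>"] that by simp
  \<comment> \<open>The moment with \<alpha> = 1 + 2\<beta> converges at \<sigma>, so \<sigma> is at
    least the abscissa given by the formula. The condition \<beta> \<le> d/2 is exactly the range in
    which the formula is assumed for k = 1.\<close>
  have key: "b * (1 - 2 * \<beta> / d) \<le> \<sigma>"
    if "order_function f \<sigma> < \<beta>" "\<beta> \<le> d / 2" "\<sigma> \<le> 1" for \<beta> \<sigma>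
  proof -
    define \<alpha> where "\<alpha> = 1 + 2 * \<beta>"
    have "\<beta> > 0" using that(1) order_function_nonneg[of \<sigma>] by linarith
    hence \<alpha>: "\<alpha> > 1" by (simp add: \<alpha>_def)
    have \<alpha>_le: "(\<alpha> - 1) / d \<le> 1" using that d_pos by (simp add: \<alpha>_def)
    have "Lp_abscissa f (2 * real 1) \<alpha> \<le> \<sigma>"
    proof (rule Lp_abscissa_bounds(2)[where L = 0])
      show "0 \<le> 1 / 2 - (\<alpha> - 1) / (2 * d * real 1)"
        using \<alpha>_le d_pos by (simp add: divide_simps)
      show "order_function f \<sigma> < (\<alpha> - 1) / (2 * real 1)" using that by (simp add: \<alpha>_def)
    qed (use \<alpha> lower that in auto)
    thus ?thesis using eq[OF \<alpha> \<alpha>_le] by (simp add: b_def \<alpha>_def)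
  qed
  show False
  proof (cases "b = 1")
    case True
    obtain \<beta> where \<beta>: "order_function f (1 / 2) < \<beta>" "\<beta> < d / 4" using dense[OF mu] by blast
    have "1 - 2 * \<beta> / d \<le> 1 / 2" using key[OF \<beta>(1)] \<beta> d_pos True by simp
    thus False using \<beta> d_pos by (simp add: field_simps)
  next
    case False
    hence b1: "b < 1" using b by simp
    \<comment> \<open>\<open>u\<close> is the bound on the order at 1 - b obtained by reflecting b;
      \<open>v\<close> is the \<beta> solving b (1 - 2\<beta>/d) = 1 - b. Any \<beta> strictly
      between them violates \<open>key\<close> at 1 - b.\<close>
    define u where "u = d * (b - 1 / 2)"
    define v where "v = d * (b - 1 / 2) / b"
    have u: "u > 0" using b d_pos by (simp add: u_def)
    have uv: "u < v" unfolding v_def u_def[symmetric] using u b b1 by (simp add: field_simps)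
    have v: "v \<le> d / 2" using b b1 d_pos by (simp add: v_def field_simps)
    obtain \<beta> where \<beta>: "u < \<beta>" "\<beta> < v" using dense[OF uv] by blast
    \<comment> \<open>Order 0 at b makes only positive exponents admissible for certain. Reflection
      carries the slack e - u to exponent e at 1 - b, still below \<beta>.\<close>
    obtain e where e: "u < e" "e < \<beta>" using dense[OF \<beta>(1)] by blast
    have "order_function f b = 0" by (rule order_abscissa_properties(4)) (simp add: b_def)
    hence "admissible (1 - (1 - b)) (e - u)" using e by (intro order_function_less_imp_admissible) simp
    hence "admissible (1 - b) (e - u + d * (1 / 2 - (1 - b)))"
      by (rule admissible_reflect) (use e u in \<open>simp add: u_def algebra_simps\<close>)
    moreover have "e - u + d * (1 / 2 - (1 - b)) = e" by (simp add: u_def algebra_simps)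
    ultimately have "order_function f (1 - b) \<le> e" using order_function_le by metis
    hence "order_function f (1 - b) < \<beta>" using e by simp
    hence "b * (1 - 2 * \<beta> / d) \<le> 1 - b" by (rule key) (use \<beta> v b in auto)
    moreover have "b * (2 * \<beta> / d) < 2 * b - 1"
    proof -
      have "\<beta> * b < d * (b - 1 / 2)" using \<beta>(2) b by (simp add: v_def pos_less_divide_eq)
      thus ?thesis using d_pos by (simp add: field_simps)
    qed
    ultimately show False by (simp add: algebra_simps)
  qed
qed

end

lemma extended_selberg_strip_function:
  assumes "extended_selberg f" and "has_degree f d" and "d > 0"
  obtains C n where "strip_function f d C n"
proof -
  have ds: "has_dirichlet_series f" and cont: "has_continuation f" and nz: "\<exists>s. s \<noteq> 1 \<and> f s \<noteq> 0"
    using assms(1) by (auto simp: extended_selberg_def)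
  obtain Q r lam mu \<omega> where fe: "satisfies_functional_equation f Q r lam mu \<omega>"
    and d: "d = 2 * (\<Sum>j=1..r. lam j)"
    using assms(2) unfolding has_degree_def by blast
  obtain C n where growth: "\<forall>s. Im s \<ge> 1 \<longrightarrow> norm (f s) \<le> C * exp (norm s ^ n)"
    using continuation_properties(2)[OF cont] by blast
  \<comment> \<open>Nonvanishing somewhere off the pole must be moved into Re s > 1 by analytic
    continuation before a leading Dirichlet coefficient can be chosen.\<close>
  have nz': "\<exists>s. Re s > 1 \<and> f s \<noteq> 0"
    using nz continuation_properties(3)[OF cont] by blast
  have "strip_function f d C n"
  proof
    show "\<exists>B. \<forall>t. norm (f (Complex \<sigma> t)) \<le> B" if "\<sigma> > 1" for \<sigma>
      using dirichlet_series_bounded[OF ds that] by (metis complex.sel(1))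
    show "\<exists>(N :: nat) a \<sigma>0. N \<ge> 1 \<and> a \<noteq> 0 \<and> \<sigma>0 > 1 \<and>
      (\<forall>s. Re s \<ge> \<sigma>0 \<longrightarrow> norm (f s * of_nat N powr s - a) \<le> norm a / 2)"
      using dirichlet_series_leading_term[OF ds nz'] by metis
    show "(\<lambda>t. norm (f (Complex \<sigma> t))) \<in> O(\<lambda>t. t powr (d * (1 / 2 - \<sigma>)) * norm (f (Complex (1 - \<sigma>) t)))" for \<sigma>
      using functional_equation_bigo[OF fe] unfolding d .
  qed (use assms(3) growth continuation_properties(1)[OF cont] in auto)
  thus ?thesis by (rule that)
qed

theorem theorem2:
  fixes f :: "complex \<Rightarrow> complex" and d :: real
  assumes "extended_selberg f"
    and "has_degree f d"
    and "d \<ge> 1"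
    and "order_function f (1 / 2) < d / 4"
  shows "lindelof_hypothesis f \<longleftrightarrow>
    (\<forall>(k :: nat) (\<alpha> :: real). k \<ge> 1 \<and> \<alpha> > 1 \<and> real k \<ge> (\<alpha> - 1) / d \<longrightarrow>
       Lp_abscissa f (2 * real k) \<alpha> = order_abscissa f * (1 - (\<alpha> - 1) / (d * real k)))"
proof -
  obtain C n where "strip_function f d C n"
    using extended_selberg_strip_function[OF assms(1,2)] assms(3) by auto
  then interpret strip_function f d C n .
  show ?thesis
  proof
    assume "lindelof_hypothesis f"
    hence b: "order_abscissa f = 1 / 2" by (simp add: lindelof_hypothesis_def)
    show "\<forall>(k :: nat) (\<alpha> :: real). k \<ge> 1 \<and> \<alpha> > 1 \<and> real k \<ge> (\<alpha> - 1) / d \<longrightarrow>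
       Lp_abscissa f (2 * real k) \<alpha> = order_abscissa f * (1 - (\<alpha> - 1) / (d * real k))"
      unfolding b by (intro allI impI lindelof_imp_Lp_abscissa[OF b]) auto
  next
    assume *: "\<forall>(k :: nat) (\<alpha> :: real). k \<ge> 1 \<and> \<alpha> > 1 \<and> real k \<ge> (\<alpha> - 1) / d \<longrightarrow>
       Lp_abscissa f (2 * real k) \<alpha> = order_abscissa f * (1 - (\<alpha> - 1) / (d * real k))"
    have "order_abscissa f = 1 / 2"
    proof (rule Lp_abscissa_imp_lindelof[OF assms(4)])
      fix \<alpha> :: real assume "\<alpha> > 1" "1 \<ge> (\<alpha> - 1) / d"
      thus "Lp_abscissa f 2 \<alpha> = order_abscissa f * (1 - (\<alpha> - 1) / d)"
        using *[THEN spec, THEN spec, of 1 \<alpha>] by simp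
    qed
    thus "lindelof_hypothesis f" by (simp add: lindelof_hypothesis_def)
  qed
qed

end
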